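(* Let $A\in\{\mathbb{H},\mathbb{O}\}$, let $\Omega=\Omega_D^A$ be a circular domain, let $f=f_0+f_v\in\mathcal{S}(\Omega)$ be a slice regular function which is not slice preserving, and fix $I\in\mathbb{S}_A$. Then the following are equivalent: (1) $f$ is strongly equivalent to a $\mathbb{C}_I$-preserving function; (2) there exists a slice-preserving function $h\in\mathcal{S}_{\mathbb{R}}(\Omega)$, $h\not\equiv 0$, such that $h^2=N(f_v)$ and $\operatorname{div}(h)=\operatorname{cdiv}(f)$. In this case (with $h$ as in (2)), the function $g:=f_0+hI$ is $\mathbb{C}_I$-preserving, strongly equivalent to $f$, and therefore is a model for $f$.
   Context: $A$ is the algebra $\mathbb{H}$ of quaternions or $\mathbb{O}$ of octonions, with standard conjugation $x\mapsto x^c$; $n=\dim_{\mathbb{R}}A-1$, and $1,e_1,\dots,e_n$ is the standard orthonormal basis ($e_\ell^2=-1$). $\mathbb{S}_A=\{I\in A: I^2=-1\}$, $\mathbb{C}_I=\operatorname{span}_{\mathbb{R}}\{1,I\}$. $A_{\mathbb{C}}=A\otimes_{\mathbb{R}}\mathbb{C}$, with elements $a+\sqrt{-1}\,b$ ($a,b\in A$), complex conjugation $\overline{a+\sqrt{-1}b}=a-\sqrt{-1}b$ and $(a+\sqrt{-1}b)^c=a^c+\sqrt{-1}b^c$. For a nonempty open $D\subset\mathbb{C}$ with $\overline D=D$ (invariant under complex conjugation), $\Omega_D^A=\{\alpha+\beta I:\alpha+\sqrt{-1}\beta\in D,\ I\in\mathbb{S}_A\}$; a circular domain is a connected set of this form.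 A stem function is $F=F_1+\sqrt{-1}F_2:D\to A_{\mathbb{C}}$ with $F(\bar z)=\overline{F(z)}$ (such an $F$ is called intrinsic). It induces $f=\mathcal{I}(F):\Omega_D^A\to A$, $f(\alpha+I\beta)=F_1(\alpha+\sqrt{-1}\beta)+I\,F_2(\alpha+\sqrt{-1}\beta)$; $f$ is slice regular if $F$ is holomorphic, and $\mathcal{S}(\Omega)$ is the set of slice regular functions. $\mathcal{I}(F)*\mathcal{I}(G)=\mathcal{I}(FG)$, $f^c=\mathcal{I}(F^c)$, $\operatorname{Tr}(f)=f+f^c$, $N(f)=f*f^c$. $f$ is slice preserving if $F$ is $\mathbb{C}$-valued; $\mathcal{S}_{\mathbb{R}}(\Omega)$ is the set of slice-preserving regular functions. Every $f\in\mathcal{S}(\Omega)$ is uniquely $f=f_0+\sum_{\ell=1}^n f_\ell e_\ell$ with $f_\ell\in\mathcal{S}_{\mathbb{R}}(\Omega)$; $f_v=\sum_{\ell\ge1}f_\ell e_\ell$ is its vector part. One has $N(f)=\sum_{\ell=0}^n f_\ell^2$. $f$ is $\mathbb{C}_I$-preserving if $f_v=hI$ for some $h\in\mathcal{S}_{\mathbb{R}}(\Omega)$. For $h\in\mathcal{S}_{\mathbb{R}}(\Omega)$, $h\not\equiv0$, $\operatorname{div}(h)$ is the divisor on $D$ of the holomorphic function inducing $h$. The central divisor $\operatorname{cdiv}(f)$ is the divisor $\sum_{p\in D}\min_{1\le\ell\le n}\operatorname{ord}_p(F_\ell)\,[p]$ on $D$, where $F_\ell$ is the holomorphic function inducing $f_\ell$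 (the order is $+\infty$ everywhere if all $F_\ell\equiv0$, so a slice-preserving function never has the same $\operatorname{cdiv}$ as a non-slice-preserving one). Two functions $f,g\in\mathcal{S}(\Omega)$ are strongly equivalent if $\operatorname{Tr}(f)=\operatorname{Tr}(g)$, $N(f)=N(g)$ and $\operatorname{cdiv}(f)=\operatorname{cdiv}(g)$. If $f$ vanishes at a nonreal $q=\alpha+\beta J$, its zero set meets $\mathbb{S}_q=\{\alpha+\beta K:K\in\mathbb{S}_A\}$ either only in $q$ (an isolated nonreal zero) or in all of $\mathbb{S}_q$ (a spherical zero). A model for $f$ is a $g\in\mathcal{S}(\Omega)$ strongly equivalent to $f$ such that all isolated nonreal zeros of $g$ lie in a single slice $\mathbb{C}_J$, for some $J\in\mathbb{S}_A$. *)

theory Defs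
  imports "HOL-Complex_Analysis.Complex_Analysis"
begin

section \<open>Quaternions and octonions by Cayley-Dickson doubling\<close>

text \<open>
  No ring axioms can be imposed here: octonion multiplication is not associative.
\<close>

class conj_algebra = euclidean_space + times + one +
  fixes conjug :: "'a \<Rightarrow> 'a"

instantiation complex :: conj_algebra
begin
definition conjug_complex :: "complex \<Rightarrow> complex" where "conjug_complex = cnj"
instance ..
end

text \<open>The pair \<open>CD a b\<close> stands for \<open>a + b l\<close>, where \<open>l\<close> is the new imaginary unit.\<close>

datatype 'a cd = CD (cd_fst: 'a) (cd_snd: 'a)

lemma cd_eq_iff: "x = y \<longleftrightarrow> cd_fst x = cd_fst y \<and> cd_snd x = cd_snd y"
  by (cases x; cases y) auto

instantiation cd :: (real_vector) real_vector
begin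
definition "0 = CD 0 0"
definition "x + y = CD (cd_fst x + cd_fst y) (cd_snd x + cd_snd y)"
definition "- x = CD (- cd_fst x) (- cd_snd x)"
definition "x - y = CD (cd_fst x - cd_fst y) (cd_snd x - cd_snd y)"
definition "r *\<^sub>R x = CD (r *\<^sub>R cd_fst x) (r *\<^sub>R cd_snd x)"
instance
  by standard
    (auto simp: cd_eq_iff zero_cd_def plus_cd_def uminus_cd_def minus_cd_def scaleR_cd_def
      algebra_simps)
end

instantiation cd :: (real_inner) real_inner
begin
definition inner_cd :: "'a cd \<Rightarrow> 'a cd \<Rightarrow> real" where
  "inner_cd x y = cd_fst x \<bullet> cd_fst y + cd_snd x \<bullet> cd_snd y"
definition norm_cd :: "'a cd \<Rightarrow> real" where "norm_cd x = sqrt (x \<bullet> x)"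
definition sgn_cd :: "'a cd \<Rightarrow> 'a cd" where "sgn_cd x = x /\<^sub>R norm x"
definition dist_cd :: "'a cd \<Rightarrow> 'a cd \<Rightarrow> real" where "dist_cd x y = norm (x - y)"
definition uniformity_cd :: "('a cd \<times> 'a cd) filter" where
  "uniformity_cd = (INF e\<in>{0<..}. principal {(x, y). dist x y < e})"
definition open_cd :: "'a cd set \<Rightarrow> bool" where
  "open_cd U \<longleftrightarrow> (\<forall>x\<in>U. eventually (\<lambda>(x', y). x' = x \<longrightarrow> y \<in> U) uniformity)"
instance
  by standard
    (auto simp: cd_eq_iff zero_cd_def plus_cd_def scaleR_cd_def inner_cd_def norm_cd_def
      sgn_cd_def dist_cd_def uniformity_cd_def open_cd_def inner_commute
      inner_add_left algebra_simps add_nonneg_eq_0_iff)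
end

instantiation cd :: (euclidean_space) euclidean_space
begin
definition Basis_cd :: "'a cd set" where
  "Basis_cd = (\<lambda>b. CD b 0) ` Basis \<union> (\<lambda>b. CD 0 b) ` Basis"
instance
proof
  fix x :: "'a cd"
  show "(\<forall>u\<in>Basis. x \<bullet> u = 0) \<longleftrightarrow> x = 0"
    by (auto simp: Basis_cd_def inner_cd_def ball_Un euclidean_all_zero_iff cd_eq_iff zero_cd_def)
qed (auto simp: Basis_cd_def inner_cd_def inner_Basis split: if_splits)
end

instantiation cd :: (conj_algebra) conj_algebra
begin
definition one_cd :: "'a cd" where "1 = CD 1 0"
definition times_cd :: "'a cd \<Rightarrow> 'a cd \<Rightarrow> 'a cd" where
  "x * y = CD (cd_fst x * cd_fst y - conjug (cd_snd y) * cd_snd x)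
              (cd_snd y * cd_fst x + cd_snd x * conjug (cd_fst y))"
definition conjug_cd :: "'a cd \<Rightarrow> 'a cd" where
  "conjug x = CD (conjug (cd_fst x)) (- cd_snd x)"
instance ..
end

text \<open>
  In both types \<open>1 \<in> Basis\<close>; the standard imaginary units \<open>e\<^sub>1, \<dots>, e\<^sub>n\<close> are the elements of
  \<open>Basis - {1}\<close> (three for \<open>quat\<close>, seven for \<open>oct\<close>).
\<close>

type_synonym quat = "complex cd"
type_synonym oct = "quat cd"


section \<open>The complexified algebra and circular sets\<close>

definition imag_sphere :: "'a::conj_algebra set" where
  "imag_sphere = {I. I * I = - 1}"

definition slice_plane :: "'a::conj_algebra \<Rightarrow> 'a set" where
  "slice_plane I = span {1, I}"

text \<open>The point \<open>\<alpha> + \<beta> I\<close> for \<open>z = \<alpha> + i \<beta>\<close>.\<close>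

definition slice_point :: "complex \<Rightarrow> 'a::conj_algebra \<Rightarrow> 'a" where
  "slice_point z I = Re z *\<^sub>R 1 + Im z *\<^sub>R I"

definition Omega :: "complex set \<Rightarrow> 'a::conj_algebra set" where
  "Omega D = {slice_point z I | z I. z \<in> D \<and> I \<in> imag_sphere}"

text \<open>
  The complexification of an algebra \<open>'a\<close> is \<open>'a \<times> 'a\<close>, the pair \<open>(a, b)\<close> being \<open>a + \<surd>-1 b\<close>.
\<close>

definition ac_times :: "'a::conj_algebra \<times> 'a \<Rightarrow> 'a \<times> 'a \<Rightarrow> 'a \<times> 'a" where
  "ac_times x y = (fst x * fst y - snd x * snd y, fst x * snd y + snd x * fst y)"

definition ac_bar :: "'a::conj_algebra \<times> 'a \<Rightarrow> 'a \<times> 'a" where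
  "ac_bar x = (fst x, - snd x)"

definition ac_conjug :: "'a::conj_algebra \<times> 'a \<Rightarrow> 'a \<times> 'a" where
  "ac_conjug x = (conjug (fst x), conjug (snd x))"

definition ac_scale :: "complex \<Rightarrow> 'a::conj_algebra \<times> 'a \<Rightarrow> 'a \<times> 'a" where
  "ac_scale c x = (Re c *\<^sub>R fst x - Im c *\<^sub>R snd x, Re c *\<^sub>R snd x + Im c *\<^sub>R fst x)"

definition ac_of_complex :: "complex \<Rightarrow> 'a::conj_algebra \<times> 'a" where
  "ac_of_complex c = (Re c *\<^sub>R 1, Im c *\<^sub>R 1)"


section \<open>Slice functions\<close>

text \<open>
  Functions on \<open>Omega D\<close> are total functions whose values outside \<open>Omega D\<close> are irrelevant;
  likewise stem functions on \<open>D\<close>.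
\<close>

definition stem_function :: "complex set \<Rightarrow> (complex \<Rightarrow> 'a::conj_algebra \<times> 'a) \<Rightarrow> bool" where
  "stem_function D F \<longleftrightarrow> (\<forall>z\<in>D. F (cnj z) = ac_bar (F z))"

text \<open>The real derivative of \<open>F\<close> at each point is complex linear.\<close>

definition stem_holomorphic :: "complex set \<Rightarrow> (complex \<Rightarrow> 'a::conj_algebra \<times> 'a) \<Rightarrow> bool" where
  "stem_holomorphic D F \<longleftrightarrow> (\<forall>z\<in>D. \<exists>L. (F has_derivative (\<lambda>h. ac_scale h L)) (at z))"

definition induces ::
  "complex set \<Rightarrow> (complex \<Rightarrow> 'a::conj_algebra \<times> 'a) \<Rightarrow> ('a \<Rightarrow> 'a) \<Rightarrow> bool" where
  "induces D F f \<longleftrightarrow>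
     (\<forall>z\<in>D. \<forall>I\<in>imag_sphere. f (slice_point z I) = fst (F z) + I * snd (F z))"

text \<open>
  For a stem function \<open>F\<close> the induced function exists and is unique on \<open>Omega D\<close>; for a function
  induced by a stem function, the latter is unique on \<open>D\<close>.
\<close>

definition slice_fun :: "complex set \<Rightarrow> (complex \<Rightarrow> 'a::conj_algebra \<times> 'a) \<Rightarrow> 'a \<Rightarrow> 'a" where
  "slice_fun D F = (SOME f. induces D F f)"

definition stem_of :: "complex set \<Rightarrow> ('a::conj_algebra \<Rightarrow> 'a) \<Rightarrow> complex \<Rightarrow> 'a \<times> 'a" where
  "stem_of D f = (SOME F. stem_function D F \<and> induces D F f)"

definition slice_regular :: "complex set \<Rightarrow> ('a::conj_algebra \<Rightarrow> 'a) \<Rightarrow> bool" where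
  "slice_regular D f \<longleftrightarrow> (\<exists>F. stem_function D F \<and> stem_holomorphic D F \<and> induces D F f)"

definition slice_preserving :: "complex set \<Rightarrow> ('a::conj_algebra \<Rightarrow> 'a) \<Rightarrow> bool" where
  "slice_preserving D f \<longleftrightarrow> (\<forall>z\<in>D. stem_of D f z \<in> range ac_of_complex)"

definition slice_preserving_regular :: "complex set \<Rightarrow> ('a::conj_algebra \<Rightarrow> 'a) \<Rightarrow> bool" where
  "slice_preserving_regular D f \<longleftrightarrow> slice_regular D f \<and> slice_preserving D f"

definition star ::
  "complex set \<Rightarrow> ('a::conj_algebra \<Rightarrow> 'a) \<Rightarrow> ('a \<Rightarrow> 'a) \<Rightarrow> 'a \<Rightarrow> 'a" where
  "star D f g = slice_fun D (\<lambda>z. ac_times (stem_of D f z) (stem_of D g z))"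

definition slice_conjug :: "complex set \<Rightarrow> ('a::conj_algebra \<Rightarrow> 'a) \<Rightarrow> 'a \<Rightarrow> 'a" where
  "slice_conjug D f = slice_fun D (\<lambda>z. ac_conjug (stem_of D f z))"

definition slice_trace :: "complex set \<Rightarrow> ('a::conj_algebra \<Rightarrow> 'a) \<Rightarrow> 'a \<Rightarrow> 'a" where
  "slice_trace D f = (\<lambda>q. f q + slice_conjug D f q)"

definition slice_norm :: "complex set \<Rightarrow> ('a::conj_algebra \<Rightarrow> 'a) \<Rightarrow> 'a \<Rightarrow> 'a" where
  "slice_norm D f = star D f (slice_conjug D f)"

text \<open>
  \<open>slice_component D f b\<close> is \<open>f\<^sub>\<ell>\<close> for \<open>b = e\<^sub>\<ell>\<close> and \<open>f\<^sub>0\<close> for \<open>b = 1\<close>: the family is determined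
  on \<open>Omega D\<close> by the unique decomposition \<open>f = f\<^sub>0 + \<Sum> f\<^sub>\<ell> e\<^sub>\<ell>\<close> with slice-preserving regular
  coefficients. Left multiplication by a slice-preserving function in the star sense is pointwise
  multiplication.
\<close>

definition slice_component ::
  "complex set \<Rightarrow> ('a::conj_algebra \<Rightarrow> 'a) \<Rightarrow> 'a \<Rightarrow> 'a \<Rightarrow> 'a" where
  "slice_component D f = (SOME \<phi>.
     (\<forall>b\<in>Basis. slice_preserving_regular D (\<phi> b)) \<and>
     (\<forall>q\<in>Omega D. f q = (\<Sum>b\<in>Basis. \<phi> b q * b)))"

definition vector_part :: "complex set \<Rightarrow> ('a::conj_algebra \<Rightarrow> 'a) \<Rightarrow> 'a \<Rightarrow> 'a" where
  "vector_part D f = (\<lambda>q. \<Sum>b\<in>Basis - {1}. slice_component D f b q * b)"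

definition slice_plane_preserving ::
  "complex set \<Rightarrow> 'a::conj_algebra \<Rightarrow> ('a \<Rightarrow> 'a) \<Rightarrow> bool" where
  "slice_plane_preserving D I f \<longleftrightarrow> slice_regular D f \<and>
     (\<exists>h. slice_preserving_regular D h \<and> (\<forall>q\<in>Omega D. vector_part D f q = h q * I))"


section \<open>Divisors, strong equivalence and models\<close>

text \<open>
  \<open>zorder\<close> is unspecified for functions vanishing near the point, where the order is \<open>\<infinity>\<close>.
\<close>

definition vanishing_order :: "(complex \<Rightarrow> complex) \<Rightarrow> complex \<Rightarrow> enat" where
  "vanishing_order H p =
     (if \<forall>\<^sub>F z in nhds p. H z = 0 then \<infinity> else enat (nat (zorder H p)))"

text \<open>The complex-valued function on \<open>D\<close> inducing a slice-preserving function.\<close>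

definition complex_stem :: "complex set \<Rightarrow> ('a::conj_algebra \<Rightarrow> 'a) \<Rightarrow> complex \<Rightarrow> complex" where
  "complex_stem D h z = (THE w. stem_of D h z = ac_of_complex w)"

text \<open>A divisor on \<open>D\<close> is given by its multiplicity at each point of \<open>D\<close>.\<close>

definition slice_divisor :: "complex set \<Rightarrow> ('a::conj_algebra \<Rightarrow> 'a) \<Rightarrow> complex \<Rightarrow> enat" where
  "slice_divisor D h p = vanishing_order (complex_stem D h) p"

definition central_divisor :: "complex set \<Rightarrow> ('a::conj_algebra \<Rightarrow> 'a) \<Rightarrow> complex \<Rightarrow> enat" where
  "central_divisor D f p =
     (MIN b\<in>Basis - {1}. vanishing_order (complex_stem D (slice_component D f b)) p)"

definition strongly_equivalent ::
  "complex set \<Rightarrow> ('a::conj_algebra \<Rightarrow> 'a) \<Rightarrow> ('a \<Rightarrow> 'a) \<Rightarrow> bool" where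
  "strongly_equivalent D f g \<longleftrightarrow> slice_regular D f \<and> slice_regular D g \<and>
     (\<forall>q\<in>Omega D. slice_trace D f q = slice_trace D g q) \<and>
     (\<forall>q\<in>Omega D. slice_norm D f q = slice_norm D g q) \<and>
     (\<forall>p\<in>D. central_divisor D f p = central_divisor D g p)"

definition isolated_nonreal_zero :: "complex set \<Rightarrow> ('a::conj_algebra \<Rightarrow> 'a) \<Rightarrow> 'a \<Rightarrow> bool" where
  "isolated_nonreal_zero D g q \<longleftrightarrow>
     (\<exists>z\<in>D. \<exists>J\<in>imag_sphere. Im z \<noteq> 0 \<and> q = slice_point z J \<and>
        {x \<in> slice_point z ` imag_sphere. g x = 0} = {q})"

definition model_for ::
  "complex set \<Rightarrow> ('a::conj_algebra \<Rightarrow> 'a) \<Rightarrow> ('a \<Rightarrow> 'a) \<Rightarrow> bool" where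
  "model_for D f g \<longleftrightarrow> slice_regular D g \<and> strongly_equivalent D g f \<and>
     (\<exists>J\<in>imag_sphere. \<forall>q. isolated_nonreal_zero D g q \<longrightarrow> q \<in> slice_plane J)"

end

theory Submission
  imports Defs
begin

text \<open>
  Everything is read off from the coordinates \<open>F\<^sub>b\<close> of the stem function \<open>F\<close> of \<open>f\<close> in the standard
  basis: these are holomorphic functions on \<open>D\<close> commuting with complex conjugation, the trace of
  \<open>f\<close> is induced by \<open>2 F\<^sub>1\<close> (index \<open>1\<close> being the real unit), the norm by \<open>\<Sum>\<^sub>b F\<^sub>b\<^sup>2\<close>, and the
  central divisor is the minimal order of the \<open>F\<^sub>b\<close>, \<open>b \<noteq> 1\<close>. Hence strong equivalence of \<open>f\<close> and
  \<open>g\<close> means equality of the real coordinates, of the sums of squares of the imaginary ones, and of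
  the minimal orders. If \<open>g\<^sub>v = h I\<close>, the imaginary coordinates of \<open>g\<close> are the real multiples
  \<open>(I \<bullet> b) H\<close> of the stem \<open>H\<close> of \<open>h\<close>; as \<open>I\<close> is a unit vector, their squares sum to \<open>H\<^sup>2\<close> and
  their minimal order is that of \<open>H\<close>. Finally, if \<open>f\<^sub>0 + h I\<close> vanishes at a point of a sphere
  outside the plane of \<open>I\<close>, left alternativity forces \<open>f\<^sub>0\<close> and \<open>h\<close> to vanish on that sphere.
\<close>

section \<open>Conjugation algebras\<close>

text \<open>The laws shared by quaternions and octonions, so that both are treated at once.
  Associativity is replaced by \<open>conjug_mult_cancel\<close>, a form of left alternativity, and
  \<open>conjug_eq\<close> ties conjugation to the inner product.\<close>

class alternative_conj_algebra = conj_algebra +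
  assumes cmult_add_left: "(x + y) * z = x * z + y * z"
    and cmult_add_right: "z * (x + y) = z * x + z * y"
    and cmult_scaleR_left: "(r *\<^sub>R x) * y = r *\<^sub>R (x * y)"
    and cmult_scaleR_right: "x * (r *\<^sub>R y) = r *\<^sub>R (x * y)"
    and cmult_one_left: "1 * x = x"
    and cmult_one_right: "x * 1 = x"
    and conjug_eq: "conjug x = (2 * (x \<bullet> 1)) *\<^sub>R 1 - x"
    and conjug_mult: "conjug (x * y) = conjug y * conjug x"
    and conjug_mult_cancel: "conjug x * (x * y) = (x \<bullet> x) *\<^sub>R y"
    and one_in_Basis: "1 \<in> Basis"
    and Basis_not_singleton: "Basis - {1} \<noteq> {}"

lemma one_inner_one: "(1::'a::alternative_conj_algebra) \<bullet> 1 = 1"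
  using one_in_Basis inner_same_Basis by blast

lemma conjug_conjug:
  fixes x :: "'a::alternative_conj_algebra"
  shows "conjug (conjug x) = x"
  by (simp add: conjug_eq inner_diff_left one_inner_one scaleR_left_diff_distrib[symmetric])

lemma inner_conjug:
  fixes x :: "'a::alternative_conj_algebra"
  shows "conjug x \<bullet> conjug x = x \<bullet> x"
  by (simp add: conjug_eq inner_diff_left inner_diff_right one_inner_one inner_commute algebra_simps)

lemma conjug_add:
  fixes x y :: "'a::alternative_conj_algebra"
  shows "conjug (x + y) = conjug x + conjug y"
  by (simp add: conjug_eq inner_add_left algebra_simps)

lemma conjug_diff:
  fixes x y :: "'a::alternative_conj_algebra"
  shows "conjug (x - y) = conjug x - conjug y"
  by (simp add: conjug_eq inner_diff_left algebra_simps)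

lemma conjug_minus:
  fixes x :: "'a::alternative_conj_algebra"
  shows "conjug (- x) = - conjug x"
  by (simp add: conjug_eq algebra_simps)

lemma conjug_mult_self:
  fixes x :: "'a::alternative_conj_algebra"
  shows "conjug x * x = (x \<bullet> x) *\<^sub>R 1"
  using conjug_mult_cancel[of x 1] by (simp add: cmult_one_right)

lemma mult_conjug_self:
  fixes x :: "'a::alternative_conj_algebra"
  shows "x * conjug x = (x \<bullet> x) *\<^sub>R 1"
  using conjug_mult_self[of "conjug x"] by (simp add: conjug_conjug inner_conjug)

lemma cmult_zero_left:
  fixes x :: "'a::alternative_conj_algebra"
  shows "0 * x = 0"
  using cmult_add_left[of 0 0 x] by simp

lemma cmult_zero_right:
  fixes x :: "'a::alternative_conj_algebra"
  shows "x * 0 = 0"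
  using cmult_add_right[of x 0 0] by simp

lemma cmult_minus_left:
  fixes x y :: "'a::alternative_conj_algebra"
  shows "(- x) * y = - (x * y)"
  using cmult_add_left[of x "-x" y] by (simp add: cmult_zero_left eq_neg_iff_add_eq_0 add.commute)

lemma cmult_minus_right:
  fixes x y :: "'a::alternative_conj_algebra"
  shows "x * (- y) = - (x * y)"
  using cmult_add_right[of x y "-y"] by (simp add: cmult_zero_right eq_neg_iff_add_eq_0 add.commute)

lemma cmult_diff_left:
  fixes x y z :: "'a::alternative_conj_algebra"
  shows "(x - y) * z = x * z - y * z"
  using cmult_add_left[of x "-y" z] by (simp add: cmult_minus_left)

lemma cmult_diff_right:
  fixes x y z :: "'a::alternative_conj_algebra"
  shows "z * (x - y) = z * x - z * y"
  using cmult_add_right[of z x "-y"] by (simp add: cmult_minus_right)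

lemma cmult_sum_right:
  fixes z :: "'a::alternative_conj_algebra"
  shows "z * (\<Sum>i\<in>A. g i) = (\<Sum>i\<in>A. z * g i)"
  by (induction A rule: infinite_finite_induct) (simp_all add: cmult_zero_right cmult_add_right)

text \<open>Polarization of \<open>mult_conjug_self\<close>, applied to
  \<open>x + y\<close>.\<close>

lemma mult_conjug_add:
  fixes x y :: "'a::alternative_conj_algebra"
  shows "x * conjug y + y * conjug x = (2 * (x \<bullet> y)) *\<^sub>R 1"
proof -
  have "x * conjug x + (x * conjug y + y * conjug x) + y * conjug y = (x + y) * conjug (x + y)"
    by (simp add: conjug_add cmult_add_left cmult_add_right)
  also have "\<dots> = (x \<bullet> x) *\<^sub>R 1 + (2 * (x \<bullet> y)) *\<^sub>R 1 + (y \<bullet> y) *\<^sub>R 1"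
    by (simp add: mult_conjug_self inner_add_left inner_add_right inner_commute[of y x]
        flip: scaleR_add_left)
  finally show ?thesis by (simp add: mult_conjug_self)
qed

class associative_conj_algebra = alternative_conj_algebra +
  assumes cmult_assoc: "(x * y) * z = x * (y * z)"

class commutative_conj_algebra = associative_conj_algebra +
  assumes cmult_commute: "x * y = y * x"

lemma cmult_left_commute:
  fixes x y z :: "'a::commutative_conj_algebra"
  shows "x * (y * z) = y * (x * z)"
  by (metis cmult_assoc cmult_commute)

instance complex :: commutative_conj_algebra
proof
  fix x y z :: complex and r :: real
  show "(x + y) * z = x * z + y * z" "z * (x + y) = z * x + z * y"
    by (simp_all add: ring_distribs)
  show "(r *\<^sub>R x) * y = r *\<^sub>R (x * y)" "x * (r *\<^sub>R y) = r *\<^sub>R (x * y)"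
    by simp_all
  show "1 * x = x" "x * 1 = x"
    by simp_all
  show "(x * y) * z = x * (y * z)" "x * y = y * x"
    by simp_all
  show "conjug x = (2 * (x \<bullet> 1)) *\<^sub>R 1 - x"
    by (simp add: conjug_complex_def complex_eq_iff inner_complex_def)
  show "conjug (x * y) = conjug y * conjug x"
    by (simp add: conjug_complex_def)
  show "conjug x * (x * y) = (x \<bullet> x) *\<^sub>R y"
    by (simp add: conjug_complex_def complex_eq_iff inner_complex_def algebra_simps)
  show "1 \<in> (Basis :: complex set)"
    by (simp add: Basis_complex_def)
  have "\<i> \<in> Basis - {1::complex}" by (simp add: Basis_complex_def)
  thus "Basis - {1::complex} \<noteq> {}" by blast
qed

section \<open>Cayley-Dickson doubling of conjugation algebras\<close>

lemma cd_sel [simp]: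
  "cd_fst 0 = 0" "cd_snd 0 = 0"
  "cd_fst (x + y) = cd_fst x + cd_fst y" "cd_snd (x + y) = cd_snd x + cd_snd y"
  "cd_fst (x - y) = cd_fst x - cd_fst y" "cd_snd (x - y) = cd_snd x - cd_snd y"
  "cd_fst (- x) = - cd_fst x" "cd_snd (- x) = - cd_snd x"
  "cd_fst (r *\<^sub>R x) = r *\<^sub>R cd_fst x" "cd_snd (r *\<^sub>R x) = r *\<^sub>R cd_snd x"
  by (simp_all add: zero_cd_def plus_cd_def minus_cd_def uminus_cd_def scaleR_cd_def)

lemma cd_sel_mult [simp]:
  "cd_fst (u * v) = cd_fst u * cd_fst v - conjug (cd_snd v) * cd_snd u"
  "cd_snd (u * v) = cd_snd v * cd_fst u + cd_snd u * conjug (cd_fst v)"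
  "cd_fst 1 = 1" "cd_snd 1 = 0"
  "cd_fst (conjug u) = conjug (cd_fst u)" "cd_snd (conjug u) = - cd_snd u"
  by (simp_all add: times_cd_def one_cd_def conjug_cd_def)

text \<open>
  Doubling loses one property at each step: \<open>complex\<close> is commutative, hence \<open>quat\<close> is associative
  and \<open>oct\<close> alternative.
\<close>

instance cd :: (associative_conj_algebra) alternative_conj_algebra
proof
  fix x y z :: "'a cd" and r :: real
  note lin = cmult_add_left cmult_add_right cmult_diff_left cmult_diff_right
    cmult_minus_left cmult_minus_right cmult_scaleR_left cmult_scaleR_right
    conjug_add conjug_diff conjug_minus
  have sc: "conjug (r *\<^sub>R a) = r *\<^sub>R conjug a" for a :: 'a
    by (simp add: conjug_eq algebra_simps)
  have c1: "conjug (1::'a) = 1"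
    by (simp add: conjug_eq one_inner_one scaleR_2)
  show "(x + y) * z = x * z + y * z" "z * (x + y) = z * x + z * y"
    by (simp_all add: cd_eq_iff lin)
  show "(r *\<^sub>R x) * y = r *\<^sub>R (x * y)" "x * (r *\<^sub>R y) = r *\<^sub>R (x * y)"
    by (simp_all add: cd_eq_iff lin sc scaleR_diff_right scaleR_add_right)
  have c0: "conjug (0::'a) = 0"
    by (simp add: conjug_eq)
  show "1 * x = x" "x * 1 = x"
    by (simp_all add: cd_eq_iff cmult_one_left cmult_one_right cmult_zero_left cmult_zero_right c0 c1)
  show "conjug x = (2 * (x \<bullet> 1)) *\<^sub>R 1 - x"
    by (simp add: cd_eq_iff inner_cd_def conjug_eq)
  show "conjug (x * y) = conjug y * conjug x"
    by (simp add: cd_eq_iff lin conjug_mult conjug_conjug)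
  \<comment> \<open>Once associativity has bracketed all products to the right, these rules turn
    neighbouring conjugate factors into squared norms; the mixed terms of the two coordinates then
    cancel.\<close>
  have R: "a * (b * conjug b) = (b \<bullet> b) *\<^sub>R a" "a * (conjug b * b) = (b \<bullet> b) *\<^sub>R a" for a b :: 'a
    by (simp_all add: mult_conjug_self conjug_mult_self cmult_scaleR_right cmult_one_right)
  have L: "b * (conjug b * a) = (b \<bullet> b) *\<^sub>R a" for a b :: 'a
    using conjug_mult_cancel[of "conjug b" a] by (simp add: conjug_conjug inner_conjug)
  show "conjug x * (x * y) = (x \<bullet> x) *\<^sub>R y"
    by (simp add: cd_eq_iff lin conjug_mult conjug_conjug cmult_assoc R L conjug_mult_cancel
        inner_cd_def scaleR_add_left)
  have b: "CD 1 0 \<in> (Basis :: 'a cd set)"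
    by (simp add: Basis_cd_def one_in_Basis)
  show "1 \<in> (Basis :: 'a cd set)"
    using b by (simp add: one_cd_def)
  have "CD 0 1 \<in> (Basis :: 'a cd set)" "CD 0 1 \<noteq> (1 :: 'a cd)"
    using one_in_Basis[where 'a='a] nonzero_Basis[OF one_in_Basis[where 'a='a]]
    by (auto simp: Basis_cd_def one_cd_def)
  thus "Basis - {1 :: 'a cd} \<noteq> {}" by blast
qed

instance cd :: (commutative_conj_algebra) associative_conj_algebra
proof
  fix x y z :: "'a cd"
  show "x * y * z = x * (y * z)"
    by (simp add: cd_eq_iff cmult_add_left cmult_add_right cmult_diff_left cmult_diff_right
        conjug_add conjug_diff conjug_mult conjug_conjug)
      (simp add: cmult_assoc cmult_commute cmult_left_commute algebra_simps)
qed

section \<open>Imaginary units and the planes they span\<close>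

lemma cmult_self:
  fixes x :: "'a::alternative_conj_algebra"
  shows "x * x = (2 * (x \<bullet> 1)) *\<^sub>R x - (x \<bullet> x) *\<^sub>R 1"
proof -
  have "x * conjug x = (2 * (x \<bullet> 1)) *\<^sub>R x - x * x"
    by (simp add: conjug_eq cmult_diff_right cmult_scaleR_right cmult_one_right)
  thus ?thesis by (simp add: mult_conjug_self)
qed

text \<open>By \<open>cmult_self\<close>, the equation \<open>I * I = - 1\<close> is a linear
  relation between \<open>I\<close> and \<open>1\<close>. Pairing it with \<open>1\<close> and with
  \<open>I\<close> gives two real equations for \<open>I \<bullet> 1\<close> and
  \<open>I \<bullet> I\<close>.\<close>

lemma imag_sphere_iff:
  fixes I :: "'a::alternative_conj_algebra"
  shows "I \<in> imag_sphere \<longleftrightarrow> I \<bullet> 1 = 0 \<and> I \<bullet> I = 1"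
proof
  assume "I \<in> imag_sphere"
  hence "I * I = - 1" by (simp add: imag_sphere_def)
  hence "(2 * (I \<bullet> 1)) *\<^sub>R I - (I \<bullet> I) *\<^sub>R 1 = - 1"
    unfolding cmult_self .
  hence "((2 * (I \<bullet> 1)) *\<^sub>R I - (I \<bullet> I) *\<^sub>R 1) \<bullet> y = (- 1) \<bullet> y" for y
    by (rule arg_cong)
  from this[of 1] this[of I]
  have 1: "I \<bullet> I - 1 = 2 * (I \<bullet> 1) * (I \<bullet> 1)"
    and 2: "2 * (I \<bullet> 1) * (I \<bullet> I) = (I \<bullet> I - 1) * (I \<bullet> 1)"
    by (simp_all add: inner_diff_left one_inner_one inner_commute[of 1 I] left_diff_distrib)
  have "I \<bullet> 1 = 0"
  proof (rule ccontr)
    assume "I \<bullet> 1 \<noteq> 0"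
    \<comment> \<open>The factor \<open>I \<bullet> I + 1\<close> is positive, so the real part has
      to vanish.\<close>
    moreover from 2 have "(I \<bullet> 1) * (I \<bullet> I + 1) = 0" by (simp add: algebra_simps)
    ultimately show False using inner_ge_zero[of I] by (simp add: add_nonneg_eq_0_iff)
  qed
  with 1 show "I \<bullet> 1 = 0 \<and> I \<bullet> I = 1" by simp
qed (simp add: imag_sphere_def cmult_self)

lemma imag_sphere_nonempty: "\<exists>I. I \<in> (imag_sphere :: 'a::alternative_conj_algebra set)"
proof -
  obtain b :: 'a where "b \<in> Basis" "b \<noteq> 1" using Basis_not_singleton by blast
  thus ?thesis
    using one_in_Basis[where 'a='a] by (intro exI[of _ b]) (simp add: imag_sphere_iff inner_Basis)
qed

lemma uminus_imag_sphere: "I \<in> imag_sphere \<Longrightarrow> - I \<in> (imag_sphere :: 'a::alternative_conj_algebra set)"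
  by (simp add: imag_sphere_iff)

lemma norm_imag_sphere: "I \<in> imag_sphere \<Longrightarrow> norm (I :: 'a::alternative_conj_algebra) = 1"
  by (simp add: imag_sphere_iff norm_eq_sqrt_inner)

lemma conjug_imag_sphere: "I \<in> imag_sphere \<Longrightarrow> conjug I = - (I :: 'a::alternative_conj_algebra)"
  by (simp add: imag_sphere_iff conjug_eq)

text \<open>This is \<open>conjug_mult_cancel\<close> with \<open>conjug I = - I\<close>. It makes
  left multiplication by \<open>I\<close> invertible without associativity.\<close>

lemma imag_sphere_mult_cancel:
  fixes I :: "'a::alternative_conj_algebra"
  assumes "I \<in> imag_sphere" shows "I * (I * y) = - y"
proof -
  have "- (I * (I * y)) = y"
    using conjug_mult_cancel[of I y] assms
    by (simp add: conjug_imag_sphere cmult_minus_left) (simp add: imag_sphere_iff)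
  thus ?thesis by (metis minus_minus)
qed

lemma slice_plane_eq: "slice_plane I = {a *\<^sub>R 1 + b *\<^sub>R I | a b. True}"
proof -
  have "x - k *\<^sub>R 1 = b *\<^sub>R I \<longleftrightarrow> x = k *\<^sub>R 1 + b *\<^sub>R I" for x k b
    by (simp add: diff_eq_eq add.commute)
  thus ?thesis
    unfolding slice_plane_def span_insert span_singleton by auto
qed

text \<open>Orthogonality to \<open>1\<close> removes the real part of \<open>I\<close>, so
  \<open>I\<close> is a nonzero real multiple of \<open>K\<close> and the relation can be
  inverted.\<close>

lemma imag_sphere_slice_plane:
  fixes I :: "'a::alternative_conj_algebra"
  assumes "I \<in> imag_sphere" "K \<in> imag_sphere" "I \<in> slice_plane K"
  shows "K \<in> slice_plane I"
proof -
  obtain a b where ab: "I = a *\<^sub>R 1 + b *\<^sub>R K" using assms(3) by (auto simp: slice_plane_eq)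
  have "a = 0"
    using arg_cong[OF ab, of "\<lambda>x. x \<bullet> 1"] assms by (simp add: imag_sphere_iff inner_add_left one_inner_one)
  hence "I = b *\<^sub>R K" "b \<noteq> 0" using ab assms(1) by (auto simp: imag_sphere_iff)
  hence "K = 0 *\<^sub>R 1 + (1/b) *\<^sub>R I" by simp
  thus ?thesis unfolding slice_plane_eq by blast
qed

section \<open>Stem functions and their coordinates\<close>

locale symmetric_domain =
  fixes D :: "complex set"
  assumes open_domain: "open D" and cnj_domain: "\<And>z. z \<in> D \<Longrightarrow> cnj z \<in> D"
begin

text \<open>\<open>slice_fun\<close> is a choice, so some induced function has to be exhibited. A
  nonreal point is represented both by \<open>z, J\<close> and by \<open>cnj z, - J\<close>; the
  stem condition makes the two values agree.\<close>

lemma induces_slice_fun: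
  fixes F :: "complex \<Rightarrow> 'a::alternative_conj_algebra \<times> 'a"
  assumes F: "stem_function D F"
  shows "induces D F (slice_fun D F)"
proof -
  \<comment> \<open>Of the two representations, the one with nonnegative imaginary part
    \<open>norm v\<close> is taken. At a real point \<open>v = 0\<close>, and the imaginary unit
    becomes \<open>0\<close>.\<close>
  define f where "f = (\<lambda>q::'a. let v = q - (q \<bullet> 1) *\<^sub>R 1; z = Complex (q \<bullet> 1) (norm v) in
    fst (F z) + ((1 / norm v) *\<^sub>R v) * snd (F z))"
  have "f (slice_point z J) = fst (F z) + J * snd (F z)" if z: "z \<in> D" and J: "J \<in> imag_sphere" for z J
  proof -
    have 1: "slice_point z J \<bullet> 1 = Re z"
      using J by (simp add: slice_point_def imag_sphere_iff inner_add_left one_inner_one)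
    have 2: "f (slice_point z J) = fst (F (Complex (Re z) \<bar>Im z\<bar>)) +
        ((Im z / \<bar>Im z\<bar>) *\<^sub>R J) * snd (F (Complex (Re z) \<bar>Im z\<bar>))"
      unfolding f_def 1 using J by (simp add: slice_point_def norm_imag_sphere Let_def)
    have bar: "F (cnj z) = (fst (F z), - snd (F z))"
      using F z by (simp add: stem_function_def ac_bar_def)
    consider "Im z = 0" | "Im z > 0" | "Im z < 0" by linarith
    thus ?thesis
    proof cases
      case 1
      hence "cnj z = z" by (simp add: complex_eq_iff)
      \<comment> \<open>At a real point the stem condition forces the second component to vanish, so
        the choice of unit does not affect the value.\<close>
      hence "snd (F z) = - snd (F z)" using bar by (metis snd_conv)
      hence "snd (F z) = 0" by (simp add: eq_neg_iff_add_eq_0 flip: scaleR_2)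
      moreover have "Complex (Re z) \<bar>Im z\<bar> = z" using 1 by (simp add: complex_eq_iff)
      ultimately show ?thesis by (simp add: 2 cmult_zero_right)
    next
      case c: 2
      hence "Complex (Re z) \<bar>Im z\<bar> = z" by (simp add: complex_eq_iff)
      thus ?thesis using c by (simp add: 2)
    next
      case 3
      hence "Complex (Re z) \<bar>Im z\<bar> = cnj z" by (simp add: complex_eq_iff)
      thus ?thesis using 3 by (simp add: 2 bar cmult_minus_left cmult_minus_right)
    qed
  qed
  hence "induces D F f" by (simp add: induces_def)
  thus ?thesis unfolding slice_fun_def by (rule someI[of "induces D F"])
qed

text \<open>Evaluating at \<open>J\<close> and at \<open>- J\<close> and adding isolates the first
  components; left multiplication by \<open>J\<close> then recovers the second ones.\<close>

lemma stem_unique: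
  fixes F G :: "complex \<Rightarrow> 'a::alternative_conj_algebra \<times> 'a"
  assumes "induces D F f" "induces D G g" "\<forall>q\<in>Omega D. f q = g q" "z \<in> D"
  shows "F z = G z"
proof -
  obtain J :: 'a where J: "J \<in> imag_sphere" using imag_sphere_nonempty by blast
  have eq: "fst (F z) + K * snd (F z) = fst (G z) + K * snd (G z)" if "K \<in> imag_sphere" for K
  proof -
    have "slice_point z K \<in> Omega D" using that assms(4) by (auto simp: Omega_def)
    hence "f (slice_point z K) = g (slice_point z K)" using assms(3) by blast
    moreover have "f (slice_point z K) = fst (F z) + K * snd (F z)"
      and "g (slice_point z K) = fst (G z) + K * snd (G z)"
      using assms(1,2,4) that unfolding induces_def by blast+
    ultimately show ?thesis by simp
  qed
  have e1: "fst (F z) + J * snd (F z) = fst (G z) + J * snd (G z)"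
    and e2: "fst (F z) - J * snd (F z) = fst (G z) - J * snd (G z)"
    using eq[OF J] eq[OF uminus_imag_sphere[OF J]] by (simp_all add: cmult_minus_left)
  have "2 *\<^sub>R fst (F z) = 2 *\<^sub>R fst (G z)"
    using arg_cong2[OF e1 e2, of "(+)"] by (simp add: scaleR_2)
  hence 1: "fst (F z) = fst (G z)" by simp
  hence "J * snd (F z) = J * snd (G z)" using e1 by simp
  hence "J * (J * snd (F z)) = J * (J * snd (G z))" by simp
  thus ?thesis using 1 by (simp add: imag_sphere_mult_cancel[OF J] prod_eq_iff)
qed

text \<open>Replaces the chosen stem by any stem at hand. The equality holds on \<open>D\<close>
  only, as stems are arbitrary elsewhere.\<close>

lemma stem_of_eq:
  fixes F :: "complex \<Rightarrow> 'a::alternative_conj_algebra \<times> 'a"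
  assumes "stem_function D F" "induces D F f" "z \<in> D"
  shows "stem_of D f z = F z"
proof -
  have "stem_function D (stem_of D f) \<and> induces D (stem_of D f) f"
    unfolding stem_of_def by (rule someI[of _ F]) (use assms in blast)
  thus ?thesis using stem_unique[of "stem_of D f" f F f z] assms(2,3) by blast
qed

lemma Omega_eqI:
  assumes "induces D F f" "induces D G g" "\<And>z. z \<in> D \<Longrightarrow> F z = G z" "q \<in> Omega D"
  shows "f q = g q"
  using assms by (auto simp: Omega_def induces_def)

end

section \<open>Complex coordinates on the complexified algebra\<close>

definition stem_comp :: "'a::conj_algebra \<times> 'a \<Rightarrow> 'a \<Rightarrow> complex" where
  "stem_comp x b = Complex (fst x \<bullet> b) (snd x \<bullet> b)"

lemma Re_stem_comp [simp]: "Re (stem_comp x b) = fst x \<bullet> b"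
  and Im_stem_comp [simp]: "Im (stem_comp x b) = snd x \<bullet> b"
  by (simp_all add: stem_comp_def)

definition stem_assemble :: "('a::conj_algebra \<Rightarrow> complex) \<Rightarrow> 'a \<times> 'a" where
  "stem_assemble H = (\<Sum>b\<in>Basis. Re (H b) *\<^sub>R b, \<Sum>b\<in>Basis. Im (H b) *\<^sub>R b)"

lemma stem_comp_assemble: "b \<in> Basis \<Longrightarrow> stem_comp (stem_assemble H) b = H b"
  by (simp add: stem_comp_def stem_assemble_def inner_sum_left_Basis complex_eq_iff)

lemma stem_assemble_comp: "stem_assemble (stem_comp x) = x"
  by (simp add: stem_assemble_def euclidean_representation)

lemma stem_eqI: "(\<And>b. b \<in> Basis \<Longrightarrow> stem_comp x b = stem_comp y b) \<Longrightarrow> x = y"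
  by (auto simp: stem_comp_def prod_eq_iff intro: euclidean_eqI)

lemma stem_comp_of_complex:
  fixes b :: "'a::alternative_conj_algebra"
  assumes "b \<in> Basis"
  shows "stem_comp (ac_of_complex w) b = (if b = 1 then w else 0)"
  using assms one_in_Basis[where 'a='a]
  by (auto simp: stem_comp_def ac_of_complex_def inner_Basis complex_eq_iff)

context symmetric_domain
begin

lemma stem_function_iff_comp:
  "stem_function D F \<longleftrightarrow> (\<forall>b\<in>Basis. \<forall>z\<in>D. stem_comp (F (cnj z)) b = cnj (stem_comp (F z) b))"
proof -
  have "F (cnj z) = ac_bar (F z) \<longleftrightarrow> (\<forall>b\<in>Basis. stem_comp (F (cnj z)) b = cnj (stem_comp (F z) b))" for z
    by (auto simp: complex_eq_iff ac_bar_def prod_eq_iff intro!: euclidean_eqI[of "fst _"] euclidean_eqI[of "snd _"])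
  thus ?thesis unfolding stem_function_def by blast
qed

text \<open>Complex linearity of the real derivative can be tested on coordinates: the coordinate of
  \<open>ac_scale h L\<close> at \<open>b\<close> is the complex product of \<open>h\<close> with
  that of \<open>L\<close>. This makes the library of holomorphic functions applicable.\<close>

lemma stem_holomorphic_iff_comp:
  "stem_holomorphic D F \<longleftrightarrow> (\<forall>b\<in>Basis. (\<lambda>z. stem_comp (F z) b) holomorphic_on D)"
proof
  assume F: "stem_holomorphic D F"
  show "\<forall>b\<in>Basis. (\<lambda>z. stem_comp (F z) b) holomorphic_on D"
    unfolding holomorphic_on_open[OF open_domain]
  proof safe
    fix b z assume "z \<in> D"
    then obtain L where L: "(F has_derivative (\<lambda>h. ac_scale h L)) (at z)"
      using F by (auto simp: stem_holomorphic_def)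
    have "((\<lambda>z. of_real (fst (F z) \<bullet> b) + \<i> * of_real (snd (F z) \<bullet> b)) has_derivative
        (\<lambda>h. of_real (fst (ac_scale h L) \<bullet> b) + \<i> * of_real (snd (ac_scale h L) \<bullet> b))) (at z)"
      by (intro derivative_intros has_derivative_of_real L has_derivative_fst has_derivative_snd)
    also have "(\<lambda>h. of_real (fst (ac_scale h L) \<bullet> b) + \<i> * of_real (snd (ac_scale h L) \<bullet> b)) =
        (*) (stem_comp L b)"
      by (auto simp: fun_eq_iff complex_eq_iff ac_scale_def inner_diff_left inner_add_left algebra_simps)
    also have "(\<lambda>z. of_real (fst (F z) \<bullet> b) + \<i> * of_real (snd (F z) \<bullet> b)) = (\<lambda>z. stem_comp (F z) b)"
      by (auto simp: complex_eq_iff)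
    finally show "\<exists>f'. ((\<lambda>z. stem_comp (F z) b) has_field_derivative f') (at z)"
      by (auto simp: has_field_derivative_def)
  qed
next
  assume H: "\<forall>b\<in>Basis. (\<lambda>z. stem_comp (F z) b) holomorphic_on D"
  show "stem_holomorphic D F"
    unfolding stem_holomorphic_def
  proof
    fix z assume z: "z \<in> D"
    have "\<forall>b\<in>Basis. \<exists>d. ((\<lambda>z. stem_comp (F z) b) has_field_derivative d) (at z)"
      using H z by (auto simp: holomorphic_on_open[OF open_domain])
    then obtain d where d: "\<And>b. b \<in> Basis \<Longrightarrow> ((\<lambda>z. stem_comp (F z) b) has_field_derivative d b) (at z)"
      by metis
    have "((\<lambda>z. stem_assemble (stem_comp (F z))) has_derivative
       (\<lambda>h. (\<Sum>b\<in>Basis. Re (d b * h) *\<^sub>R b, \<Sum>b\<in>Basis. Im (d b * h) *\<^sub>R b))) (at z)"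
      unfolding stem_assemble_def
      by (intro has_derivative_Pair has_derivative_sum has_derivative_scaleR_left
          bounded_linear.has_derivative[OF bounded_linear_Re]
          bounded_linear.has_derivative[OF bounded_linear_Im]
          d[unfolded has_field_derivative_def])
    \<comment> \<open>The complex derivatives of the coordinates are reassembled into the vector
      \<open>L\<close> required by the definition.\<close>
    also have "(\<lambda>h. (\<Sum>b\<in>Basis. Re (d b * h) *\<^sub>R b, \<Sum>b\<in>Basis. Im (d b * h) *\<^sub>R b)) =
        (\<lambda>h. ac_scale h (stem_assemble d))"
      by (auto simp: fun_eq_iff ac_scale_def stem_assemble_def scaleR_sum_right algebra_simps
          simp flip: sum_subtractf sum.distrib)
    finally show "\<exists>L. (F has_derivative (\<lambda>h. ac_scale h L)) (at z)"
      unfolding stem_assemble_comp by blast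
  qed
qed

end

section \<open>Regular and slice-preserving functions with explicit stems\<close>

definition regular_stem ::
  "complex set \<Rightarrow> (complex \<Rightarrow> 'a::conj_algebra \<times> 'a) \<Rightarrow> ('a \<Rightarrow> 'a) \<Rightarrow> bool" where
  "regular_stem D F f \<longleftrightarrow> stem_function D F \<and> stem_holomorphic D F \<and> induces D F f"

text \<open>Keeps the intrinsic holomorphic function behind a slice-preserving regular one as an
  explicit argument, in place of the choice in \<open>stem_of\<close> and the description in
  \<open>complex_stem\<close>.\<close>

definition scalar_stem ::
  "complex set \<Rightarrow> (complex \<Rightarrow> complex) \<Rightarrow> ('a::conj_algebra \<Rightarrow> 'a) \<Rightarrow> bool" where
  "scalar_stem D H h \<longleftrightarrow> H holomorphic_on D \<and> (\<forall>z\<in>D. H (cnj z) = cnj (H z)) \<and>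
     induces D (\<lambda>z. ac_of_complex (H z)) h"

lemma induces_cong_stem:
  "(\<And>z. z \<in> D \<Longrightarrow> F z = G z) \<Longrightarrow> induces D F f \<longleftrightarrow> induces D G f"
  by (simp add: induces_def)

lemma ac_of_complex_inject:
  "ac_of_complex v = (ac_of_complex w :: 'a::alternative_conj_algebra \<times> 'a) \<longleftrightarrow> v = w"
proof
  assume "ac_of_complex v = (ac_of_complex w :: 'a \<times> 'a)"
  hence "stem_comp (ac_of_complex v :: 'a \<times> 'a) 1 = stem_comp (ac_of_complex w :: 'a \<times> 'a) 1"
    by simp
  thus "v = w" by (simp add: stem_comp_of_complex one_in_Basis)
qed simp

lemma scalar_stem_cong:
  assumes "\<And>z. z \<in> D \<Longrightarrow> G z = H z" "scalar_stem D H h" "\<And>z. z \<in> D \<Longrightarrow> cnj z \<in> D"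
  shows "scalar_stem D G h"
  using assms(2,3) holomorphic_cong[OF refl assms(1)]
    induces_cong_stem[of D "\<lambda>z. ac_of_complex (G z)" "\<lambda>z. ac_of_complex (H z)" h] assms(1)
  unfolding scalar_stem_def by simp

lemma scalar_stem_zero: "scalar_stem D (\<lambda>_. 0) (\<lambda>_. 0 :: 'a::alternative_conj_algebra)"
  by (simp add: scalar_stem_def induces_def ac_of_complex_def cmult_zero_right)

context symmetric_domain
begin

lemma scalar_stem_imp_regular_stem:
  fixes h :: "'a::alternative_conj_algebra \<Rightarrow> 'a"
  assumes "scalar_stem D H h"
  shows "regular_stem D (\<lambda>z. ac_of_complex (H z)) h"
proof -
  have "(\<lambda>z. if b = 1 then H z else 0) holomorphic_on D" for b :: 'a
    using assms by (cases "b = 1") (simp_all add: scalar_stem_def)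
  thus ?thesis
    using assms by (simp add: regular_stem_def scalar_stem_def stem_function_iff_comp
        stem_holomorphic_iff_comp stem_comp_of_complex)
qed

text \<open>Slice preservation is defined through the chosen stem. By uniqueness it passes to a
  holomorphic stem, whose coordinate at \<open>1\<close> is the required \<open>H\<close>.\<close>

lemma slice_preserving_regular_iff:
  fixes h :: "'a::alternative_conj_algebra \<Rightarrow> 'a"
  shows "slice_preserving_regular D h \<longleftrightarrow> (\<exists>H. scalar_stem D H h)"
proof
  assume h: "slice_preserving_regular D h"
  then obtain F where F: "stem_function D F" "stem_holomorphic D F" "induces D F h"
    by (auto simp: slice_preserving_regular_def slice_regular_def)
  define H where "H z = stem_comp (F z) 1" for z
  have eq: "F z = ac_of_complex (H z)" if z: "z \<in> D" for z
  proof -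
    have "F z \<in> range ac_of_complex"
      using h stem_of_eq[OF F(1,3) z] z
      unfolding slice_preserving_regular_def slice_preserving_def by metis
    then obtain w where "F z = ac_of_complex w" by blast
    thus ?thesis by (simp add: H_def stem_comp_of_complex one_in_Basis)
  qed
  have "H holomorphic_on D" "\<forall>z\<in>D. H (cnj z) = cnj (H z)"
    using F(1,2) one_in_Basis
    unfolding H_def stem_function_iff_comp stem_holomorphic_iff_comp by blast+
  moreover have "induces D (\<lambda>z. ac_of_complex (H z)) h"
    using F(3) induces_cong_stem[of D F "\<lambda>z. ac_of_complex (H z)" h] eq by blast
  ultimately show "\<exists>H. scalar_stem D H h" by (auto simp: scalar_stem_def)
next
  assume "\<exists>H. scalar_stem D H h"
  then obtain H where "scalar_stem D H h" by blast
  hence H: "regular_stem D (\<lambda>z. ac_of_complex (H z)) h" by (rule scalar_stem_imp_regular_stem)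
  hence "stem_of D h z = ac_of_complex (H z)" if "z \<in> D" for z
    using stem_of_eq that unfolding regular_stem_def by blast
  with H show "slice_preserving_regular D h"
    unfolding slice_preserving_regular_def slice_regular_def slice_preserving_def regular_stem_def
    by auto
qed

lemma complex_stem_eq:
  fixes h :: "'a::alternative_conj_algebra \<Rightarrow> 'a"
  assumes "scalar_stem D H h" "z \<in> D"
  shows "complex_stem D h z = H z"
proof -
  have "stem_of D h z = ac_of_complex (H z)"
    using scalar_stem_imp_regular_stem[OF assms(1)] assms(2) stem_of_eq
    unfolding regular_stem_def by blast
  thus ?thesis unfolding complex_stem_def by (simp add: ac_of_complex_inject)
qed

text \<open>The coefficients take values in real combinations of \<open>1\<close> and
  \<open>J\<close>, so bilinearity is enough to rewrite each summand, also in the octonions.\<close>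

lemma regular_stem_sum:
  fixes \<phi> :: "'a::alternative_conj_algebra \<Rightarrow> 'a \<Rightarrow> 'a"
  assumes \<phi>: "\<And>b. b \<in> Basis \<Longrightarrow> scalar_stem D (H b) (\<phi> b)"
  shows "regular_stem D (\<lambda>z. stem_assemble (\<lambda>b. H b z)) (\<lambda>q. \<Sum>b\<in>Basis. \<phi> b q * b)"
proof -
  have "(\<Sum>b\<in>Basis. \<phi> b (slice_point z J) * b) =
      fst (stem_assemble (\<lambda>b. H b z)) + J * snd (stem_assemble (\<lambda>b. H b z))"
    if "z \<in> D" "J \<in> imag_sphere" for z J
  proof -
    have "\<phi> b (slice_point z J) * b = Re (H b z) *\<^sub>R b + J * (Im (H b z) *\<^sub>R b)" if "b \<in> Basis" for b
      using \<phi>[OF that] \<open>z \<in> D\<close> \<open>J \<in> imag_sphere\<close>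
      by (simp add: scalar_stem_def induces_def ac_of_complex_def cmult_add_left cmult_scaleR_left
          cmult_scaleR_right cmult_one_left cmult_one_right)
    thus ?thesis by (simp add: stem_assemble_def sum.distrib cmult_sum_right)
  qed
  thus ?thesis
    using \<phi> by (simp add: regular_stem_def induces_def stem_function_iff_comp
        stem_holomorphic_iff_comp stem_comp_assemble scalar_stem_def)
qed

text \<open>The components are a chosen family. Existence of such a family makes the choice
  meaningful, and uniqueness of stems shows that every such family has the coordinates of
  \<open>F\<close> as its stems.\<close>

lemma scalar_stem_component:
  fixes f :: "'a::alternative_conj_algebra \<Rightarrow> 'a"
  assumes f: "regular_stem D F f" and b: "b \<in> Basis"
  shows "scalar_stem D (\<lambda>z. stem_comp (F z) b) (slice_component D f b)"
proof -
  \<comment> \<open>The functions induced by the coordinates of \<open>F\<close> witness the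
    existence of a decomposition.\<close>
  define \<psi> where "\<psi> b = slice_fun D (\<lambda>z. ac_of_complex (stem_comp (F z) b) :: 'a \<times> 'a)" for b
  have \<psi>: "scalar_stem D (\<lambda>z. stem_comp (F z) b) (\<psi> b)" if b: "b \<in> Basis" for b
  proof -
    have "(\<lambda>z. stem_comp (F z) b) holomorphic_on D"
      and c: "\<forall>z\<in>D. stem_comp (F (cnj z)) b = cnj (stem_comp (F z) b)"
      using f b unfolding regular_stem_def stem_function_iff_comp stem_holomorphic_iff_comp
      by blast+
    moreover have "stem_function D (\<lambda>z. ac_of_complex (stem_comp (F z) b) :: 'a \<times> 'a)"
      using c by (simp add: stem_function_iff_comp stem_comp_of_complex)
    ultimately show ?thesis
      unfolding scalar_stem_def \<psi>_def using induces_slice_fun by blast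
  qed
  have "induces D F (\<lambda>q. \<Sum>b\<in>Basis. \<psi> b q * b)"
    using regular_stem_sum[of "\<lambda>b z. stem_comp (F z) b" \<psi>] \<psi>
    by (simp add: regular_stem_def stem_assemble_comp)
  hence "\<forall>q\<in>Omega D. f q = (\<Sum>b\<in>Basis. \<psi> b q * b)"
    using f Omega_eqI[of F f F] unfolding regular_stem_def by blast
  moreover have "\<forall>b\<in>Basis. slice_preserving_regular D (\<psi> b)"
    using \<psi> by (auto simp: slice_preserving_regular_iff)
  ultimately have "\<exists>\<phi>. (\<forall>b\<in>Basis. slice_preserving_regular D (\<phi> b)) \<and>
      (\<forall>q\<in>Omega D. f q = (\<Sum>b\<in>Basis. \<phi> b q * b))"
    by blast
  hence comp: "(\<forall>b\<in>Basis. slice_preserving_regular D (slice_component D f b)) \<and>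
      (\<forall>q\<in>Omega D. f q = (\<Sum>b\<in>Basis. slice_component D f b q * b))"
    unfolding slice_component_def by (rule someI_ex)
  then obtain H where H: "\<And>b. b \<in> Basis \<Longrightarrow> scalar_stem D (H b) (slice_component D f b)"
    unfolding slice_preserving_regular_iff by metis
  have "stem_comp (F z) b = H b z" if "z \<in> D" for z
  proof -
    \<comment> \<open>Whatever family was chosen, assembling its scalar stems gives another stem of
      \<open>f\<close>, which has to be \<open>F\<close> on \<open>D\<close>.\<close>
    have "F z = stem_assemble (\<lambda>b. H b z)"
      using regular_stem_sum[of H "slice_component D f", OF H] f comp that stem_unique[of F f]
      unfolding regular_stem_def by blast
    thus ?thesis using b by (simp add: stem_comp_assemble)
  qed
  thus ?thesis by (rule scalar_stem_cong[OF _ H[OF b] cnj_domain])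
qed

text \<open>The vector part is a full sum over \<open>Basis\<close> whose coefficient at
  \<open>1\<close> is the zero function, so \<open>regular_stem_sum\<close> applies.\<close>

lemma regular_stem_vector_part:
  fixes f :: "'a::alternative_conj_algebra \<Rightarrow> 'a"
  assumes f: "regular_stem D F f"
  shows "regular_stem D (\<lambda>z. stem_assemble (\<lambda>b. if b = 1 then 0 else stem_comp (F z) b)) (vector_part D f)"
proof -
  define \<phi> where "\<phi> b = (if b = 1 then (\<lambda>_. 0) else slice_component D f b)" for b
  have "scalar_stem D (\<lambda>z. if b = 1 then 0 else stem_comp (F z) b) (\<phi> b)" if "b \<in> Basis" for b
    using scalar_stem_component[OF f that] by (simp add: \<phi>_def scalar_stem_zero)
  moreover have "(\<Sum>b\<in>Basis. \<phi> b q * b) = vector_part D f q" for q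
    unfolding vector_part_def \<phi>_def
    by (subst sum.remove[OF finite_Basis one_in_Basis]) (simp add: cmult_zero_left)
  ultimately show ?thesis
    using regular_stem_sum[of "\<lambda>b z. if b = 1 then 0 else stem_comp (F z) b" \<phi>] by simp
qed

end

section \<open>Conjugation, products, norm and trace on the level of stems\<close>

lemma ac_times_conjug:
  fixes x :: "'a::alternative_conj_algebra \<times> 'a"
  shows "ac_times x (ac_conjug x) = ac_of_complex (\<Sum>b\<in>Basis. (stem_comp x b)\<^sup>2)"
proof -
  \<comment> \<open>The two components of the product are given by \<open>mult_conjug_self\<close>
    and by its polarization \<open>mult_conjug_add\<close>; they are matched here with the real and
    imaginary part of the sum of squares.\<close>
  have re: "Re (\<Sum>b\<in>Basis. (stem_comp x b)\<^sup>2) = fst x \<bullet> fst x - snd x \<bullet> snd x"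
    by (subst (1 2) euclidean_inner) (simp add: power2_eq_square sum_subtractf)
  have im: "Im (\<Sum>b\<in>Basis. (stem_comp x b)\<^sup>2) = 2 * (fst x \<bullet> snd x)"
    by (subst euclidean_inner) (simp add: power2_eq_square sum_distrib_left algebra_simps)
  show ?thesis
    by (simp only: ac_times_def ac_conjug_def ac_of_complex_def re im fst_conv snd_conv
        mult_conjug_self mult_conjug_add scaleR_diff_left)
qed

lemma ac_times_of_complex:
  "ac_times (ac_of_complex v) (ac_of_complex w) = (ac_of_complex (v * w) :: 'a::alternative_conj_algebra \<times> 'a)"
  by (simp add: ac_times_def ac_of_complex_def cmult_scaleR_left cmult_one_left
      scaleR_diff_left scaleR_add_left)

context symmetric_domain
begin

lemma induces_slice_conjug:
  fixes f :: "'a::alternative_conj_algebra \<Rightarrow> 'a"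
  assumes F: "stem_function D F" "induces D F f"
  shows "stem_function D (\<lambda>z. ac_conjug (F z))"
    and "induces D (\<lambda>z. ac_conjug (F z)) (slice_conjug D f)"
proof -
  show st: "stem_function D (\<lambda>z. ac_conjug (F z))"
    using F(1) by (simp add: stem_function_def ac_conjug_def ac_bar_def conjug_minus)
  have eq: "ac_conjug (stem_of D f z) = ac_conjug (F z)" if "z \<in> D" for z
    using stem_of_eq[OF F that] by simp
  have "stem_function D (\<lambda>z. ac_conjug (stem_of D f z))"
    using st cnj_domain by (simp add: stem_function_def eq)
  thus "induces D (\<lambda>z. ac_conjug (F z)) (slice_conjug D f)"
    unfolding slice_conjug_def
    using induces_slice_fun eq induces_cong_stem[of D "\<lambda>z. ac_conjug (stem_of D f z)" "\<lambda>z. ac_conjug (F z)"]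
    by blast
qed

lemma induces_star:
  fixes f g :: "'a::alternative_conj_algebra \<Rightarrow> 'a"
  assumes F: "stem_function D F" "induces D F f" and G: "stem_function D G" "induces D G g"
  shows "induces D (\<lambda>z. ac_times (F z) (G z)) (star D f g)"
proof -
  have eq: "ac_times (stem_of D f z) (stem_of D g z) = ac_times (F z) (G z)" if "z \<in> D" for z
    using stem_of_eq[OF F that] stem_of_eq[OF G that] by simp
  have "stem_function D (\<lambda>z. ac_times (F z) (G z))"
    using F(1) G(1)
    by (simp add: stem_function_def ac_times_def ac_bar_def cmult_minus_left cmult_minus_right)
  hence "stem_function D (\<lambda>z. ac_times (stem_of D f z) (stem_of D g z))"
    using cnj_domain by (simp add: stem_function_def eq)
  thus ?thesis
    unfolding star_def
    using induces_slice_fun eq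
      induces_cong_stem[of D "\<lambda>z. ac_times (stem_of D f z) (stem_of D g z)" "\<lambda>z. ac_times (F z) (G z)"]
    by blast
qed

lemma induces_slice_norm:
  fixes f :: "'a::alternative_conj_algebra \<Rightarrow> 'a"
  assumes "regular_stem D F f"
  shows "induces D (\<lambda>z. ac_of_complex (\<Sum>b\<in>Basis. (stem_comp (F z) b)\<^sup>2)) (slice_norm D f)"
proof -
  have F: "stem_function D F" "induces D F f" using assms by (auto simp: regular_stem_def)
  show ?thesis
    using induces_star[OF F induces_slice_conjug[OF F]] by (simp add: slice_norm_def ac_times_conjug)
qed

lemma induces_star_scalar:
  fixes h :: "'a::alternative_conj_algebra \<Rightarrow> 'a"
  assumes "scalar_stem D H h"
  shows "induces D (\<lambda>z. ac_of_complex ((H z)\<^sup>2)) (star D h h)"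
  using scalar_stem_imp_regular_stem[OF assms] induces_star
  unfolding regular_stem_def power2_eq_square ac_times_of_complex[symmetric] by blast

lemma induces_slice_trace:
  fixes f :: "'a::alternative_conj_algebra \<Rightarrow> 'a"
  assumes "regular_stem D F f"
  shows "induces D (\<lambda>z. ac_of_complex (2 * stem_comp (F z) 1)) (slice_trace D f)"
proof -
  have F: "stem_function D F" "induces D F f" using assms by (auto simp: regular_stem_def)
  show ?thesis
    using F(2) induces_slice_conjug(2)[OF F]
    by (auto simp: induces_def slice_trace_def ac_conjug_def ac_of_complex_def conjug_eq cmult_diff_right)
qed

text \<open>Turns identities between traces or norms on \<open>Omega D\<close> into identities
  between complex functions on \<open>D\<close>.\<close>

lemma Omega_eq_iff_scalar:
  fixes f g :: "'a::alternative_conj_algebra \<Rightarrow> 'a"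
  assumes "induces D (\<lambda>z. ac_of_complex (A z)) f" "induces D (\<lambda>z. ac_of_complex (B z)) g"
  shows "(\<forall>q\<in>Omega D. f q = g q) \<longleftrightarrow> (\<forall>z\<in>D. A z = B z)"
proof
  assume "\<forall>q\<in>Omega D. f q = g q"
  thus "\<forall>z\<in>D. A z = B z" using stem_unique[OF assms] ac_of_complex_inject[where 'a='a] by blast
next
  assume "\<forall>z\<in>D. A z = B z"
  thus "\<forall>q\<in>Omega D. f q = g q" using Omega_eqI[OF assms] by simp
qed

end

section \<open>Vanishing orders and divisors\<close>

lemma vanishing_order_cong:
  assumes "\<forall>\<^sub>F z in nhds p. G z = H z"
  shows "vanishing_order G p = vanishing_order H p"
proof -
  have "(\<forall>\<^sub>F z in nhds p. G z = 0) \<longleftrightarrow> (\<forall>\<^sub>F z in nhds p. H z = 0)"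
    by (rule eventually_cong[OF assms]) simp
  moreover have "zorder G p = zorder H p"
    by (rule zorder_cong) (use assms in \<open>auto simp: eventually_nhds_conv_at\<close>)
  ultimately show ?thesis by (simp add: vanishing_order_def)
qed

lemma vanishing_order_cmult:
  "c \<noteq> 0 \<Longrightarrow> vanishing_order (\<lambda>z. c * H z) p = vanishing_order H p"
  by (simp add: vanishing_order_def zorder_cmult)

lemma vanishing_order_zero: "vanishing_order (\<lambda>_. 0) p = \<infinity>"
  by (simp add: vanishing_order_def)

context symmetric_domain
begin

text \<open>As \<open>D\<close> is open, agreement on \<open>D\<close> is agreement of germs at each
  of its points, so the arbitrary values outside \<open>D\<close> do no harm.\<close>

lemma vanishing_order_cong_domain:
  assumes "\<And>z. z \<in> D \<Longrightarrow> G z = H z" "p \<in> D"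
  shows "vanishing_order G p = vanishing_order H p"
  by (intro vanishing_order_cong eventually_mono[OF eventually_nhds_in_open[OF open_domain assms(2)]] assms(1))

lemma slice_divisor_eq:
  fixes h :: "'a::alternative_conj_algebra \<Rightarrow> 'a"
  assumes "scalar_stem D H h" "p \<in> D"
  shows "slice_divisor D h p = vanishing_order H p"
  unfolding slice_divisor_def using complex_stem_eq[OF assms(1)] assms(2)
  by (rule vanishing_order_cong_domain)

lemma central_divisor_eq:
  fixes f :: "'a::alternative_conj_algebra \<Rightarrow> 'a"
  assumes "regular_stem D F f" "p \<in> D"
  shows "central_divisor D f p = (MIN b\<in>Basis - {1}. vanishing_order (\<lambda>z. stem_comp (F z) b) p)"
proof -
  have "vanishing_order (complex_stem D (slice_component D f b)) p =
      vanishing_order (\<lambda>z. stem_comp (F z) b) p" if "b \<in> Basis - {1}" for b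
    using slice_divisor_eq[OF scalar_stem_component[OF assms(1)] assms(2), of b] that
    by (simp add: slice_divisor_def)
  thus ?thesis unfolding central_divisor_def by simp
qed

end

section \<open>Functions preserving the plane of an imaginary unit\<close>

text \<open>Since \<open>I\<close> is orthogonal to \<open>1\<close>, the coordinate at
  \<open>1\<close> is \<open>u\<close> alone, and the others are those of
  \<open>w I\<close>.\<close>

lemma stem_assemble_plane:
  fixes I :: "'a::alternative_conj_algebra"
  assumes "I \<in> imag_sphere"
  shows "stem_assemble (\<lambda>b. if b = 1 then u else of_real (I \<bullet> b) * w) =
    ac_of_complex u + (Re w *\<^sub>R I, Im w *\<^sub>R I)"
proof (rule stem_eqI)
  fix b :: 'a assume b: "b \<in> Basis"
  hence "1 \<bullet> b = (if b = 1 then 1 else 0)"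
    using one_in_Basis[where 'a='a] by (auto simp: inner_Basis)
  moreover have "I \<bullet> 1 = 0" using assms by (simp add: imag_sphere_iff)
  ultimately show "stem_comp (stem_assemble (\<lambda>b. if b = 1 then u else of_real (I \<bullet> b) * w)) b =
      stem_comp (ac_of_complex u + (Re w *\<^sub>R I, Im w *\<^sub>R I)) b"
    using b by (simp add: stem_comp_assemble complex_eq_iff ac_of_complex_def inner_add_left)
qed

text \<open>Parseval for the unit vector \<open>I\<close>, whose coordinate at \<open>1\<close> is
  zero.\<close>

lemma sum_squares_plane:
  fixes I :: "'a::alternative_conj_algebra"
  assumes "I \<in> imag_sphere"
  shows "(\<Sum>b\<in>Basis - {1}. (complex_of_real (I \<bullet> b) * w)\<^sup>2) = w\<^sup>2"
proof -
  have "(\<Sum>b\<in>Basis - {1}. (complex_of_real (I \<bullet> b) * w)\<^sup>2) = (\<Sum>b\<in>Basis. (complex_of_real (I \<bullet> b) * w)\<^sup>2)"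
    using assms sum.remove[OF finite_Basis one_in_Basis, of "\<lambda>b. (complex_of_real (I \<bullet> b) * w)\<^sup>2"]
    by (simp add: imag_sphere_iff)
  also have "\<dots> = of_real (\<Sum>b\<in>Basis. (I \<bullet> b) * (I \<bullet> b)) * w\<^sup>2"
    by (simp add: power2_eq_square sum_distrib_left algebra_simps)
  also have "\<dots> = w\<^sup>2"
    using assms by (simp add: imag_sphere_iff flip: euclidean_inner)
  finally show ?thesis .
qed

lemma imag_sphere_coordinate:
  fixes I :: "'a::alternative_conj_algebra"
  assumes "I \<in> imag_sphere"
  obtains b where "b \<in> Basis - {1}" "I \<bullet> b \<noteq> 0"
proof -
  have "\<exists>b\<in>Basis. I \<bullet> b \<noteq> 0"
    using assms euclidean_all_zero_iff[of I] by (auto simp: imag_sphere_iff)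
  thus ?thesis using assms that by (auto simp: imag_sphere_iff)
qed

text \<open>A nonzero real factor preserves the order and a zero factor makes it infinite; the
  minimum is attained because some imaginary coordinate of \<open>I\<close> is nonzero.\<close>

lemma Min_vanishing_order_plane:
  fixes I :: "'a::alternative_conj_algebra"
  assumes "I \<in> imag_sphere"
  shows "(MIN b\<in>Basis - {1}. vanishing_order (\<lambda>z. of_real (I \<bullet> b) * H z) p) = vanishing_order H p"
proof (rule Min_eqI)
  fix n assume "n \<in> (\<lambda>b. vanishing_order (\<lambda>z. of_real (I \<bullet> b) * H z) p) ` (Basis - {1})"
  then obtain b where "n = vanishing_order (\<lambda>z. of_real (I \<bullet> b) * H z) p" by blast
  thus "vanishing_order H p \<le> n"
    by (cases "I \<bullet> b = 0") (simp_all add: vanishing_order_zero vanishing_order_cmult)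
next
  obtain b where b: "b \<in> Basis - {1}" "I \<bullet> b \<noteq> 0" using imag_sphere_coordinate[OF assms] .
  hence "vanishing_order H p = vanishing_order (\<lambda>z. of_real (I \<bullet> b) * H z) p"
    by (simp add: vanishing_order_cmult)
  thus "vanishing_order H p \<in> (\<lambda>b. vanishing_order (\<lambda>z. of_real (I \<bullet> b) * H z) p) ` (Basis - {1})"
    using b(1) by (rule image_eqI)
qed simp

text \<open>Put \<open>x = c + d J\<close>. Multiplying \<open>x * I = - (a + b J)\<close> on the
  left by \<open>conjug x\<close> gives a multiple of \<open>I\<close> lying in the plane of
  \<open>J\<close>. As \<open>J\<close> is outside the plane of \<open>I\<close>, that multiple is
  zero, hence \<open>x = 0\<close>, and \<open>a\<close>, \<open>b\<close> vanish by
  orthogonality.\<close>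

lemma plane_combination_eq_0:
  fixes I J :: "'a::alternative_conj_algebra"
  assumes I: "I \<in> imag_sphere" and J: "J \<in> imag_sphere" "J \<notin> slice_plane I"
    and eq: "(a *\<^sub>R 1 + b *\<^sub>R J) + (c *\<^sub>R 1 + d *\<^sub>R J) * I = 0"
  shows "a = 0 \<and> b = 0 \<and> c = 0 \<and> d = 0"
proof -
  define x where "x = c *\<^sub>R 1 + d *\<^sub>R J"
  have J1: "J \<bullet> 1 = 0" "1 \<bullet> J = 0" "J \<bullet> J = 1"
    using J(1) by (simp_all add: imag_sphere_iff inner_commute)
  have xx: "x \<bullet> x = c\<^sup>2 + d\<^sup>2"
    by (simp add: x_def inner_add_left inner_add_right J1 one_inner_one power2_eq_square)
  have "x * I = - (a *\<^sub>R 1 + b *\<^sub>R J)"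
    using eq by (simp only: x_def eq_neg_iff_add_eq_0 add.commute)
  \<comment> \<open>Left alternativity, through \<open>conjug_mult_cancel\<close>, removes
    \<open>x\<close> from the product \<open>x * I\<close>.\<close>
  hence "(x \<bullet> x) *\<^sub>R I = conjug x * (- (a *\<^sub>R 1 + b *\<^sub>R J))"
    using conjug_mult_cancel[of x I] by simp
  also have "conjug x = (2 * c) *\<^sub>R 1 - x"
    by (simp add: conjug_eq x_def inner_add_left J1 one_inner_one)
  also have "\<dots> = c *\<^sub>R 1 - d *\<^sub>R J"
    by (simp add: x_def scaleR_2 flip: scaleR_scaleR)
  also have "(c *\<^sub>R 1 - d *\<^sub>R J) * (- (a *\<^sub>R 1 + b *\<^sub>R J)) =
      (- (c * a) - d * b) *\<^sub>R 1 + (d * a - c * b) *\<^sub>R J"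
    using J(1)
    by (simp add: cmult_minus_right cmult_diff_left cmult_diff_right cmult_add_right cmult_scaleR_left
        cmult_scaleR_right cmult_one_left cmult_one_right imag_sphere_def algebra_simps)
  finally have *: "(x \<bullet> x) *\<^sub>R I \<in> slice_plane J"
    unfolding slice_plane_eq by blast
  have "x \<bullet> x = 0"
  proof (rule ccontr)
    assume "x \<bullet> x \<noteq> 0"
    hence "I \<in> slice_plane J"
      using span_scale[OF *[unfolded slice_plane_def], of "1 / (x \<bullet> x)"] by (simp add: slice_plane_def)
    thus False using imag_sphere_slice_plane[OF I J(1)] J(2) by blast
  qed
  hence cd: "c = 0" "d = 0" by (simp_all add: xx sum_power2_eq_zero_iff)
  hence ab: "a *\<^sub>R 1 + b *\<^sub>R J = 0" using eq by (simp add: cmult_zero_left)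
  have "a = 0" "b = 0"
    using arg_cong[OF ab, of "\<lambda>y. y \<bullet> 1"] arg_cong[OF ab, of "\<lambda>y. y \<bullet> J"]
    by (simp_all add: inner_add_left J1 one_inner_one)
  with cd show ?thesis by simp
qed

section \<open>Strong equivalence, models and the two implications\<close>

context symmetric_domain
begin

text \<open>Equal traces give equal coordinates at \<open>1\<close>; their squares then drop out of
  the equation between the norms.\<close>

lemma strongly_equivalent_iff:
  fixes f g :: "'a::alternative_conj_algebra \<Rightarrow> 'a"
  assumes f: "regular_stem D F f" and g: "regular_stem D G g"
  shows "strongly_equivalent D f g \<longleftrightarrow>
    (\<forall>z\<in>D. stem_comp (F z) 1 = stem_comp (G z) 1) \<and>
    (\<forall>z\<in>D. (\<Sum>b\<in>Basis - {1}. (stem_comp (F z) b)\<^sup>2) = (\<Sum>b\<in>Basis - {1}. (stem_comp (G z) b)\<^sup>2)) \<and>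
    (\<forall>p\<in>D. central_divisor D f p = central_divisor D g p)"
proof -
  have reg: "slice_regular D f" "slice_regular D g"
    using f g unfolding slice_regular_def regular_stem_def by blast+
  have tr: "(\<forall>q\<in>Omega D. slice_trace D f q = slice_trace D g q) \<longleftrightarrow>
      (\<forall>z\<in>D. stem_comp (F z) 1 = stem_comp (G z) 1)"
    using Omega_eq_iff_scalar[OF induces_slice_trace[OF f] induces_slice_trace[OF g]] by simp
  have nm: "(\<forall>q\<in>Omega D. slice_norm D f q = slice_norm D g q) \<longleftrightarrow>
      (\<forall>z\<in>D. (stem_comp (F z) 1)\<^sup>2 + (\<Sum>b\<in>Basis - {1}. (stem_comp (F z) b)\<^sup>2) =
        (stem_comp (G z) 1)\<^sup>2 + (\<Sum>b\<in>Basis - {1}. (stem_comp (G z) b)\<^sup>2))"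
    using Omega_eq_iff_scalar[OF induces_slice_norm[OF f] induces_slice_norm[OF g]]
    by (simp add: sum.remove[OF finite_Basis one_in_Basis])
  show ?thesis
    unfolding strongly_equivalent_def tr nm using reg by auto
qed

lemma regular_stem_plane:
  fixes a h :: "'a::alternative_conj_algebra \<Rightarrow> 'a"
  assumes a: "scalar_stem D A a" and h: "scalar_stem D H h" and I: "I \<in> imag_sphere"
  shows "regular_stem D (\<lambda>z. stem_assemble (\<lambda>b. if b = 1 then A z else of_real (I \<bullet> b) * H z))
    (\<lambda>q. a q + h q * I)"
proof -
  have "(\<lambda>z. if b = 1 then A z else of_real (I \<bullet> b) * H z) holomorphic_on D" for b
    using a h by (cases "b = 1") (auto simp: scalar_stem_def intro!: holomorphic_intros)
  moreover have "induces D (\<lambda>z. stem_assemble (\<lambda>b. if b = 1 then A z else of_real (I \<bullet> b) * H z))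
      (\<lambda>q. a q + h q * I)"
    using a h unfolding stem_assemble_plane[OF I]
    by (simp add: scalar_stem_def induces_def ac_of_complex_def cmult_add_left cmult_add_right
        cmult_scaleR_left cmult_scaleR_right cmult_one_left cmult_one_right)
  ultimately show ?thesis
    using a h by (simp add: regular_stem_def stem_function_iff_comp stem_holomorphic_iff_comp
        stem_comp_assemble scalar_stem_def)
qed

text \<open>Both sides have stems with zero coordinate at \<open>1\<close>, so uniqueness of stems
  reduces the equation to the imaginary coordinates.\<close>

lemma vector_part_plane_iff:
  fixes g h :: "'a::alternative_conj_algebra \<Rightarrow> 'a"
  assumes g: "regular_stem D G g" and h: "scalar_stem D H h" and I: "I \<in> imag_sphere"
  shows "(\<forall>q\<in>Omega D. vector_part D g q = h q * I) \<longleftrightarrow>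
    (\<forall>z\<in>D. \<forall>b\<in>Basis - {1}. stem_comp (G z) b = of_real (I \<bullet> b) * H z)"
    (is "?L \<longleftrightarrow> ?R")
proof -
  let ?V = "\<lambda>z. stem_assemble (\<lambda>b. if b = 1 then 0 else stem_comp (G z) b)"
  let ?W = "\<lambda>z. stem_assemble (\<lambda>b. if b = 1 then 0 else of_real (I \<bullet> b) * H z)"
  have V: "induces D ?V (vector_part D g)"
    using regular_stem_vector_part[OF g] by (simp add: regular_stem_def)
  have W: "induces D ?W (\<lambda>q. h q * I)"
    using regular_stem_plane[OF scalar_stem_zero h I] by (simp add: regular_stem_def)
  show ?thesis
  proof
    assume ?L
    show ?R
    proof (intro ballI)
      fix z and b :: 'a assume z: "z \<in> D" and b: "b \<in> Basis - {1}"
      have "?V z = ?W z" using stem_unique[OF V W \<open>?L\<close> z] .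
      hence "stem_comp (?V z) b = stem_comp (?W z) b" by (rule arg_cong)
      thus "stem_comp (G z) b = of_real (I \<bullet> b) * H z" using b by (simp add: stem_comp_assemble)
    qed
  next
    assume ?R
    hence "?V z = ?W z" if "z \<in> D" for z
      using that by (intro stem_eqI) (simp add: stem_comp_assemble)
    thus ?L using Omega_eqI[OF V W] by blast
  qed
qed

lemma central_divisor_plane:
  fixes g :: "'a::alternative_conj_algebra \<Rightarrow> 'a"
  assumes g: "regular_stem D G g" and I: "I \<in> imag_sphere"
    and H: "\<forall>z\<in>D. \<forall>b\<in>Basis - {1}. stem_comp (G z) b = of_real (I \<bullet> b) * H z"
    and p: "p \<in> D"
  shows "central_divisor D g p = vanishing_order H p"
proof -
  have "vanishing_order (\<lambda>z. stem_comp (G z) b) p = vanishing_order (\<lambda>z. of_real (I \<bullet> b) * H z) p"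
    if "b \<in> Basis - {1}" for b
    by (rule vanishing_order_cong_domain) (use H that p in auto)
  thus ?thesis
    using central_divisor_eq[OF g p] Min_vanishing_order_plane[OF I, of H p] by simp
qed

lemma isolated_zero_in_plane:
  fixes a h :: "'a::alternative_conj_algebra \<Rightarrow> 'a"
  assumes a: "scalar_stem D A a" and h: "scalar_stem D H h" and I: "I \<in> imag_sphere"
    and q: "isolated_nonreal_zero D (\<lambda>q. a q + h q * I) q"
  shows "q \<in> slice_plane I"
proof (rule ccontr)
  let ?g = "\<lambda>q. a q + h q * I"
  assume nq: "q \<notin> slice_plane I"
  obtain z J where z: "z \<in> D" "Im z \<noteq> 0" and J: "J \<in> imag_sphere" and qz: "q = slice_point z J"
    and iso: "{x \<in> slice_point z ` imag_sphere. ?g x = 0} = {q}"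
    using q by (auto simp: isolated_nonreal_zero_def)
  have g: "?g (slice_point z K) =
      (Re (A z) *\<^sub>R 1 + Im (A z) *\<^sub>R K) + (Re (H z) *\<^sub>R 1 + Im (H z) *\<^sub>R K) * I"
    if "K \<in> imag_sphere" for K
    using a h that z(1)
    by (simp add: scalar_stem_def induces_def ac_of_complex_def cmult_scaleR_right cmult_one_right)
  have "J \<notin> slice_plane I"
    using nq unfolding qz slice_point_def slice_plane_def
    by (metis insertI1 span_add span_base span_scale)
  moreover have "?g (slice_point z J) = 0" using iso qz by blast
  ultimately have "Re (A z) = 0 \<and> Im (A z) = 0 \<and> Re (H z) = 0 \<and> Im (H z) = 0"
    using plane_combination_eq_0[OF I J] g[OF J] by metis
  \<comment> \<open>Both complex values at \<open>z\<close> are zero, so the antipodal point of the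
    sphere is a zero too. It differs from \<open>q\<close> since \<open>Im z \<noteq> 0\<close>,
    which contradicts isolation.\<close>
  hence "?g (slice_point z (- J)) = 0"
    using g[OF uminus_imag_sphere[OF J]] by (simp add: cmult_zero_left)
  hence "slice_point z (- J) = slice_point z J"
    using iso uminus_imag_sphere[OF J] qz by blast
  hence "slice_point z (- J) \<bullet> J = slice_point z J \<bullet> J" by (rule arg_cong)
  thus False
    using z(2) J by (simp add: slice_point_def inner_add_left inner_diff_left imag_sphere_iff)
qed

lemma model_from_square_root:
  fixes f h :: "'a::alternative_conj_algebra \<Rightarrow> 'a"
  assumes f: "regular_stem D F f" and h: "scalar_stem D H h" and I: "I \<in> imag_sphere"
    and sq: "\<forall>z\<in>D. (H z)\<^sup>2 = (\<Sum>b\<in>Basis - {1}. (stem_comp (F z) b)\<^sup>2)"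
    and dv: "\<forall>p\<in>D. vanishing_order H p = central_divisor D f p"
  defines "g \<equiv> \<lambda>q. slice_component D f 1 q + h q * I"
  shows "slice_plane_preserving D I g \<and> strongly_equivalent D f g \<and> model_for D f g"
proof -
  \<comment> \<open>The real coordinate is copied from \<open>F\<close>, which settles the trace;
    the imaginary ones are those of \<open>H I\<close>, with square sum \<open>H\<^sup>2\<close> and
    minimal order that of \<open>H\<close>.\<close>
  define G where "G z = stem_assemble (\<lambda>b. if b = 1 then stem_comp (F z) 1 else of_real (I \<bullet> b) * H z)" for z
  have f0: "scalar_stem D (\<lambda>z. stem_comp (F z) 1) (slice_component D f 1)"
    by (rule scalar_stem_component[OF f one_in_Basis])
  have g: "regular_stem D G g"
    unfolding g_def G_def by (rule regular_stem_plane[OF f0 h I])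
  have reg: "slice_regular D g"
    using g unfolding slice_regular_def regular_stem_def by blast
  have G: "\<forall>z\<in>D. \<forall>b\<in>Basis - {1}. stem_comp (G z) b = of_real (I \<bullet> b) * H z"
    and G1: "\<forall>z\<in>D. stem_comp (G z) 1 = stem_comp (F z) 1"
    by (simp_all add: G_def stem_comp_assemble one_in_Basis)
  have "slice_plane_preserving D I g"
    using vector_part_plane_iff[OF g h I] G reg h slice_preserving_regular_iff
    unfolding slice_plane_preserving_def by blast
  moreover have eq: "strongly_equivalent D f g"
    unfolding strongly_equivalent_iff[OF f g]
    using G G1 sq dv sum_squares_plane[OF I] central_divisor_plane[OF g I G] by simp
  moreover have "model_for D f g"
    unfolding model_for_def
  proof (intro conjI bexI[OF _ I] allI impI)
    show "strongly_equivalent D g f"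
      using eq by (simp add: strongly_equivalent_def)
    show "q \<in> slice_plane I" if "isolated_nonreal_zero D g q" for q
      using isolated_zero_in_plane[OF f0 h I] that unfolding g_def by blast
  qed (rule reg)
  ultimately show ?thesis by blast
qed

text \<open>Some imaginary coordinate is nonzero at some point \<open>p\<close>, so it does not
  vanish near \<open>p\<close> and its order there is finite. This later rules out \<open>h\<close>
  being identically zero.\<close>

lemma not_slice_preserving_imp:
  fixes f :: "'a::alternative_conj_algebra \<Rightarrow> 'a"
  assumes f: "regular_stem D F f" and "\<not> slice_preserving D f"
  obtains p where "p \<in> D" "central_divisor D f p \<noteq> \<infinity>"
proof -
  obtain p where p: "p \<in> D" "F p \<notin> range ac_of_complex"
    using assms stem_of_eq unfolding slice_preserving_def regular_stem_def by metis
  have "F p \<noteq> ac_of_complex (stem_comp (F p) 1)" using p(2) by blast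
  then obtain b where b: "b \<in> Basis" "stem_comp (F p) b \<noteq> stem_comp (ac_of_complex (stem_comp (F p) 1)) b"
    using stem_eqI by blast
  hence b': "b \<in> Basis - {1}" "stem_comp (F p) b \<noteq> 0"
    by (auto simp: stem_comp_of_complex split: if_splits)
  hence "vanishing_order (\<lambda>z. stem_comp (F z) b) p \<noteq> \<infinity>"
    by (auto simp: vanishing_order_def dest: eventually_nhds_x_imp_x)
  moreover have "central_divisor D f p \<le> vanishing_order (\<lambda>z. stem_comp (F z) b) p"
    unfolding central_divisor_eq[OF f p(1)] using b'(1) by (intro Min_le) auto
  ultimately have "central_divisor D f p \<noteq> \<infinity>" by (cases "central_divisor D f p") auto
  thus ?thesis using that p(1) by blast
qed

lemma square_root_from_plane_preserving:
  fixes f g :: "'a::alternative_conj_algebra \<Rightarrow> 'a"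
  assumes f: "regular_stem D F f" "\<not> slice_preserving D f" and I: "I \<in> imag_sphere"
    and g: "slice_plane_preserving D I g" and eq: "strongly_equivalent D f g"
  shows "\<exists>H (h :: 'a \<Rightarrow> 'a). scalar_stem D H h \<and> (\<exists>q\<in>Omega D. h q \<noteq> 0) \<and>
    (\<forall>z\<in>D. (H z)\<^sup>2 = (\<Sum>b\<in>Basis - {1}. (stem_comp (F z) b)\<^sup>2)) \<and>
    (\<forall>p\<in>D. vanishing_order H p = central_divisor D f p)"
proof -
  obtain G where G: "regular_stem D G g"
    using g by (auto simp: slice_plane_preserving_def slice_regular_def regular_stem_def)
  \<comment> \<open>The square root is the coefficient of \<open>I\<close> in the vector part of
    \<open>g\<close>.\<close>
  obtain h H where h: "scalar_stem D H h" and "\<forall>q\<in>Omega D. vector_part D g q = h q * I"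
    using g slice_preserving_regular_iff unfolding slice_plane_preserving_def by blast
  hence comp: "\<forall>z\<in>D. \<forall>b\<in>Basis - {1}. stem_comp (G z) b = of_real (I \<bullet> b) * H z"
    using vector_part_plane_iff[OF G h I] by blast
  have sq: "\<forall>z\<in>D. (H z)\<^sup>2 = (\<Sum>b\<in>Basis - {1}. (stem_comp (F z) b)\<^sup>2)"
    using eq comp sum_squares_plane[OF I] unfolding strongly_equivalent_iff[OF f(1) G] by simp
  have dv: "\<forall>p\<in>D. vanishing_order H p = central_divisor D f p"
    using eq central_divisor_plane[OF G I comp] unfolding strongly_equivalent_iff[OF f(1) G] by simp
  have "\<exists>q\<in>Omega D. h q \<noteq> 0"
  proof (rule ccontr)
    assume "\<not> ?thesis"
    hence "\<forall>z\<in>D. H z = 0"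
      using Omega_eq_iff_scalar[of H h "\<lambda>_. 0" "\<lambda>_. 0"] h scalar_stem_zero[of D, where 'a='a]
      unfolding scalar_stem_def by blast
    obtain p where p: "p \<in> D" "central_divisor D f p \<noteq> \<infinity>"
      using not_slice_preserving_imp[OF f] .
    \<comment> \<open>If \<open>h\<close> were zero, its order at \<open>p\<close> would be
      infinite, while it equals the finite central order of \<open>f\<close>.\<close>
    have "vanishing_order H p = vanishing_order (\<lambda>_. 0) p"
      by (rule vanishing_order_cong_domain) (use \<open>\<forall>z\<in>D. H z = 0\<close> p(1) in auto)
    thus False using p dv by (simp add: vanishing_order_zero)
  qed
  thus ?thesis using h sq dv by blast
qed

lemma norm_vector_part_eq_iff:
  fixes f h :: "'a::alternative_conj_algebra \<Rightarrow> 'a"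
  assumes f: "regular_stem D F f" and h: "scalar_stem D H h"
  shows "(\<forall>q\<in>Omega D. star D h h q = slice_norm D (vector_part D f) q) \<longleftrightarrow>
    (\<forall>z\<in>D. (H z)\<^sup>2 = (\<Sum>b\<in>Basis - {1}. (stem_comp (F z) b)\<^sup>2))"
proof -
  let ?V = "\<lambda>z. stem_assemble (\<lambda>b. if b = 1 then 0 else stem_comp (F z) b)"
  have "(\<Sum>b\<in>Basis. (stem_comp (?V z) b)\<^sup>2) = (\<Sum>b\<in>Basis - {1}. (stem_comp (F z) b)\<^sup>2)" for z
    by (subst sum.remove[OF finite_Basis one_in_Basis]) (simp add: stem_comp_assemble one_in_Basis)
  thus ?thesis
    using Omega_eq_iff_scalar[OF induces_star_scalar[OF h] induces_slice_norm[OF regular_stem_vector_part[OF f]]]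
    by simp
qed

end

text \<open>The common form of both halves of the theorem, to be instantiated at \<open>quat\<close>
  and at \<open>oct\<close>.\<close>

lemma plane_preserving_equivalence:
  fixes f :: "'a::alternative_conj_algebra \<Rightarrow> 'a"
  assumes "open D" "cnj ` D = D" and reg: "slice_regular D f" and np: "\<not> slice_preserving D f"
    and I: "I \<in> imag_sphere"
  defines "is_root \<equiv> \<lambda>h. slice_preserving_regular D h \<and> (\<exists>q\<in>Omega D. h q \<noteq> 0) \<and>
             (\<forall>q\<in>Omega D. star D h h q = slice_norm D (vector_part D f) q) \<and>
             (\<forall>p\<in>D. slice_divisor D h p = central_divisor D f p)"
  shows "((\<exists>g. slice_plane_preserving D I g \<and> strongly_equivalent D f g) \<longleftrightarrow> (\<exists>h. is_root h)) \<and>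
    (\<forall>h. is_root h \<longrightarrow> (let g = (\<lambda>q. slice_component D f 1 q + h q * I) in
       slice_plane_preserving D I g \<and> strongly_equivalent D f g \<and> model_for D f g))"
proof -
  interpret symmetric_domain D
    using assms(1,2) by unfold_locales auto
  obtain F where F: "regular_stem D F f"
    using reg by (auto simp: slice_regular_def regular_stem_def)
  have mod: "let g = (\<lambda>q. slice_component D f 1 q + h q * I) in
       slice_plane_preserving D I g \<and> strongly_equivalent D f g \<and> model_for D f g" if r: "is_root h" for h
  proof -
    obtain H where H: "scalar_stem D H h"
      using r slice_preserving_regular_iff unfolding is_root_def by blast
    show ?thesis
      unfolding Let_def
      by (rule model_from_square_root[OF F H I])
        (use r norm_vector_part_eq_iff[OF F H] slice_divisor_eq[OF H] in \<open>auto simp: is_root_def\<close>)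
  qed
  moreover have "\<exists>h. is_root h" if pg: "slice_plane_preserving D I g" "strongly_equivalent D f g" for g
  proof -
    obtain H and h :: "'a \<Rightarrow> 'a" where H: "scalar_stem D H h" "\<exists>q\<in>Omega D. h q \<noteq> 0"
      "\<forall>z\<in>D. (H z)\<^sup>2 = (\<Sum>b\<in>Basis - {1}. (stem_comp (F z) b)\<^sup>2)"
      "\<forall>p\<in>D. vanishing_order H p = central_divisor D f p"
      using square_root_from_plane_preserving[OF F np I pg] by blast
    have "is_root h"
      unfolding is_root_def norm_vector_part_eq_iff[OF F H(1)]
    proof (intro conjI H(2,3) ballI)
      show "slice_preserving_regular D h"
        using H(1) slice_preserving_regular_iff by blast
      show "slice_divisor D h p = central_divisor D f p" if "p \<in> D" for p
        using slice_divisor_eq[OF H(1) that] H(4) that by simp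
    qed
    thus ?thesis by blast
  qed
  ultimately show ?thesis unfolding Let_def by blast
qed

theorem theorem4p7:
  "(\<forall>(D :: complex set) (f :: quat \<Rightarrow> quat) (I :: quat).
       D \<noteq> {} \<and> open D \<and> cnj ` D = D \<and> connected (Omega D :: quat set) \<and>
       slice_regular D f \<and> \<not> slice_preserving D f \<and> I \<in> imag_sphere \<longrightarrow>
       ((\<exists>g. slice_plane_preserving D I g \<and> strongly_equivalent D f g) \<longleftrightarrow>
        (\<exists>h. slice_preserving_regular D h \<and> (\<exists>q\<in>Omega D. h q \<noteq> 0) \<and>
             (\<forall>q\<in>Omega D. star D h h q = slice_norm D (vector_part D f) q) \<and>
             (\<forall>p\<in>D. slice_divisor D h p = central_divisor D f p))) \<and>
       (\<forall>h. slice_preserving_regular D h \<and> (\<exists>q\<in>Omega D. h q \<noteq> 0) \<and>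
            (\<forall>q\<in>Omega D. star D h h q = slice_norm D (vector_part D f) q) \<and>
            (\<forall>p\<in>D. slice_divisor D h p = central_divisor D f p) \<longrightarrow>
          (let g = (\<lambda>q. slice_component D f 1 q + h q * I) in
             slice_plane_preserving D I g \<and> strongly_equivalent D f g \<and> model_for D f g))) \<and>
   (\<forall>(D :: complex set) (f :: oct \<Rightarrow> oct) (I :: oct).
       D \<noteq> {} \<and> open D \<and> cnj ` D = D \<and> connected (Omega D :: oct set) \<and>
       slice_regular D f \<and> \<not> slice_preserving D f \<and> I \<in> imag_sphere \<longrightarrow>
       ((\<exists>g. slice_plane_preserving D I g \<and> strongly_equivalent D f g) \<longleftrightarrow>
        (\<exists>h. slice_preserving_regular D h \<and> (\<exists>q\<in>Omega D. h q \<noteq> 0) \<and>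
             (\<forall>q\<in>Omega D. star D h h q = slice_norm D (vector_part D f) q) \<and>
             (\<forall>p\<in>D. slice_divisor D h p = central_divisor D f p))) \<and>
       (\<forall>h. slice_preserving_regular D h \<and> (\<exists>q\<in>Omega D. h q \<noteq> 0) \<and>
            (\<forall>q\<in>Omega D. star D h h q = slice_norm D (vector_part D f) q) \<and>
            (\<forall>p\<in>D. slice_divisor D h p = central_divisor D f p) \<longrightarrow>
          (let g = (\<lambda>q. slice_component D f 1 q + h q * I) in
             slice_plane_preserving D I g \<and> strongly_equivalent D f g \<and> model_for D f g)))"
  by (rule conjI; intro allI impI; elim conjE; rule plane_preserving_equivalence; assumption)

end
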